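(* Let $\mathbf p=(p_1,\dots,p_r)$ and $\mathbf q=(q_1,\dots,q_r)$ be probability distributions on $\mathcal X=\{c_1,\dots,c_r\}$ with $p_j>0$ and $q_j>0$ for all $j\in D$, and let $\alpha>0$, $\alpha\ne1$. Let $\widehat{\mathbf p}_n$ and $\widehat{\mathbf q}_m$ be the empirical distributions of i.i.d. samples $X_1,\dots,X_n$ from $\mathbf p$ and $Y_1,\dots,Y_m$ from $\mathbf q$. Then the following hold, where $\rightsquigarrow$ denotes convergence in distribution. (a) (One sample) As $n\to+\infty$, $$\sqrt n\,\bigl(\mathcal D_{T,\alpha}(\widehat{\mathbf p}_n,\mathbf q)-\mathcal D_{T,\alpha}(\mathbf p,\mathbf q)\bigr)\rightsquigarrow\mathcal N\bigl(0,V_{T,\alpha,1}(\mathbf p,\mathbf q)\bigr),\qquad\sqrt n\,\bigl(\mathcal D_{T,\alpha}(\mathbf p,\widehat{\mathbf q}_n)-\mathcal D_{T,\alpha}(\mathbf p,\mathbf q)\bigr)\rightsquigarrow\mathcal N\bigl(0,V_{T,\alpha,2}(\mathbf p,\mathbf q)\bigr).$$ (b) (Two samples) For $(n,m)\to(+\infty,+\infty)$ and $nm/(n+m)\to\gamma\in(0,1)$, $$\left(\frac{mn}{nV_{T,\alpha,2}(\mathbf p,\mathbf q)+mV_{T,\alpha,1}(\mathbf p,\mathbf q)}\right)^{1/2}\bigl(\mathcal D_{T,\alpha}(\widehat{\mathbf p}_n,\widehat{\mathbf q}_m)-\mathcal D_{T,\alpha}(\mathbf p,\mathbf q)\bigr)\rightsquigarrow\mathcal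 N(0,1).$$
   Context: $\mathcal X=\{c_1,\dots,c_r\}$ with $r\ge 2$ is a finite set and $D=\{1,\dots,r\}$. A probability distribution $\mathbf p$ on $\mathcal X$ is identified with the vector $(p_1,\dots,p_r)$, $p_j$ being the mass of $c_j$. $X_1,X_2,\dots$ are i.i.d. with $\mathbb P(X_i=c_j)=p_j$, and $Y_1,Y_2,\dots$ are i.i.d. with $\mathbb P(Y_i=c_j)=q_j$; the two samples are independent of each other. Empirical probabilities: $\widehat p_n^{c_j}=\frac1n\sum_{i=1}^n 1_{\{X_i=c_j\}}$, $\widehat q_m^{c_j}=\frac1m\sum_{i=1}^m 1_{\{Y_i=c_j\}}$, $\widehat{\mathbf p}_n=(\widehat p_n^{c_j})_{j\in D}$, $\widehat{\mathbf q}_m=(\widehat q_m^{c_j})_{j\in D}$. Tsallis-$\alpha$ divergence: $\mathcal D_{T,\alpha}(\mathbf p,\mathbf q)=\frac1{\alpha-1}\Bigl(\sum_{j\in D}p_j^\alpha q_j^{1-\alpha}-1\Bigr)$. $$V_{T,\alpha,1}(\mathbf p,\mathbf q)=\Bigl(\frac{\alpha}{\alpha-1}\Bigr)^2\Bigl(\sum_{j\in D}p_j(1-p_j)(p_j/q_j)^{2\alpha-2}-2\sum_{(i,j)\in D^2,\ i\neq j}(p_ip_j)^{\alpha}(q_iq_j)^{1-\alpha}\Bigr),$$ $$V_{T,\alpha,2}(\mathbf p,\mathbf q)=\sum_{j\in D}q_j(1-q_j)(p_j/q_j)^{2\alpha}-2\sum_{(i,j)\in D^2,\ i\neq j}(p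_ip_j)^{\alpha}(q_iq_j)^{1-\alpha}.$$
   Formalization: The cross sums in V_{T,α,1} and V_{T,α,2} run over i<j, since over ordered pairs the variances are wrong; in (b) the impossible nm/(n+m)→γ is vacuous, so (b) is also proved for n/(n+m)→γ∈(0,1) with nV_{T,α,2}+mV_{T,α,1} eventually nonzero. *)

theory Defs
  imports "HOL-Probability.Probability"
begin

text \<open>A probability distribution on the alphabet \<open>c 1, \<dots>, c r\<close> is identified with its mass vector,
  a function \<open>nat \<Rightarrow> real\<close> of which only the values on \<open>{1..r}\<close> matter.\<close>

definition pos_prob_vec :: "nat \<Rightarrow> (nat \<Rightarrow> real) \<Rightarrow> bool" where
  "pos_prob_vec r p \<longleftrightarrow> (\<forall>j\<in>{1..r}. 0 < p j) \<and> (\<Sum>j\<in>{1..r}. p j) = 1"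

definition alphabet :: "nat \<Rightarrow> (nat \<Rightarrow> 'c) \<Rightarrow> 'c measure" where
  "alphabet r c = count_space (c ` {1..r})"

definition iid_sample ::
  "'w measure \<Rightarrow> nat \<Rightarrow> (nat \<Rightarrow> 'c) \<Rightarrow> (nat \<Rightarrow> real) \<Rightarrow> (nat \<Rightarrow> 'w \<Rightarrow> 'c) \<Rightarrow> bool" where
  "iid_sample M r c p X \<longleftrightarrow>
     prob_space.indep_vars M (\<lambda>_. alphabet r c) X {1..} \<and>
     (\<forall>i\<ge>1. \<forall>j\<in>{1..r}. measure M {\<omega> \<in> space M. X i \<omega> = c j} = p j)"

definition indep_samples ::
  "'w measure \<Rightarrow> nat \<Rightarrow> (nat \<Rightarrow> 'c) \<Rightarrow> (nat \<Rightarrow> 'w \<Rightarrow> 'c) \<Rightarrow> (nat \<Rightarrow> 'w \<Rightarrow> 'c) \<Rightarrow> bool" where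
  "indep_samples M r c X Y \<longleftrightarrow>
     prob_space.indep_var M
       (\<Pi>\<^sub>M i\<in>{1..}. alphabet r c) (\<lambda>\<omega>. \<lambda>i\<in>{1..}. X i \<omega>)
       (\<Pi>\<^sub>M i\<in>{1..}. alphabet r c) (\<lambda>\<omega>. \<lambda>i\<in>{1..}. Y i \<omega>)"

definition empirical ::
  "(nat \<Rightarrow> 'c) \<Rightarrow> (nat \<Rightarrow> 'w \<Rightarrow> 'c) \<Rightarrow> nat \<Rightarrow> 'w \<Rightarrow> nat \<Rightarrow> real" where
  "empirical c X n \<omega> j = 1 / real n * (\<Sum>i\<in>{1..n}. of_bool (X i \<omega> = c j))"

text \<open>Since \<open>0 powr x = 0\<close>, a letter with \<open>q j = 0\<close> contributes \<open>0\<close> to the divergence also for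
  \<open>\<alpha> > 1\<close>, where the usual value is infinite if \<open>p j > 0\<close>. For an empirical \<open>q\<close> drawn from a
  positive distribution this event has probability tending to \<open>0\<close>, so no limit law depends
  on this value.\<close>

definition tsallis :: "real \<Rightarrow> nat \<Rightarrow> (nat \<Rightarrow> real) \<Rightarrow> (nat \<Rightarrow> real) \<Rightarrow> real" where
  "tsallis \<alpha> r p q = 1 / (\<alpha> - 1) * ((\<Sum>j\<in>{1..r}. p j powr \<alpha> * q j powr (1 - \<alpha>)) - 1)"

text \<open>The cross terms \<open>2 * (\<Sum>i \<noteq> j. \<dots>)\<close> of the two variances come from expanding the variance of a
  linear form in multinomial counts, so each unordered pair of distinct indices is counted
  once. (Over ordered pairs, the factor 2 would count every covariance twice, and the expression
  would be negative for instance for \<open>p = q\<close>.)\<close>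

definition distinct_pairs :: "nat \<Rightarrow> (nat \<times> nat) set" where
  "distinct_pairs r = {(i, j). i \<in> {1..r} \<and> j \<in> {1..r} \<and> i < j}"

definition V1 :: "real \<Rightarrow> nat \<Rightarrow> (nat \<Rightarrow> real) \<Rightarrow> (nat \<Rightarrow> real) \<Rightarrow> real" where
  "V1 \<alpha> r p q = (\<alpha> / (\<alpha> - 1))\<^sup>2 *
     ((\<Sum>j\<in>{1..r}. p j * (1 - p j) * (p j / q j) powr (2 * \<alpha> - 2))
      - 2 * (\<Sum>(i, j)\<in>distinct_pairs r. (p i * p j) powr \<alpha> * (q i * q j) powr (1 - \<alpha>)))"

definition V2 :: "real \<Rightarrow> nat \<Rightarrow> (nat \<Rightarrow> real) \<Rightarrow> (nat \<Rightarrow> real) \<Rightarrow> real" where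
  "V2 \<alpha> r p q =
     (\<Sum>j\<in>{1..r}. q j * (1 - q j) * (p j / q j) powr (2 * \<alpha>))
      - 2 * (\<Sum>(i, j)\<in>distinct_pairs r. (p i * p j) powr \<alpha> * (q i * q j) powr (1 - \<alpha>))"

text \<open>The variance may vanish (it does for \<open>p = q\<close>); \<open>normal_density 0 0\<close> is the zero function, so
  the degenerate case has to be given separately as the point mass.\<close>

definition centered_normal :: "real \<Rightarrow> real measure" where
  "centered_normal v =
     (if v = 0 then return borel 0 else density lborel (normal_density 0 (sqrt v)))"

definition converges_in_law :: "'w measure \<Rightarrow> (nat \<Rightarrow> 'w \<Rightarrow> real) \<Rightarrow> real measure \<Rightarrow> bool" where
  "converges_in_law M Z L \<longleftrightarrow> weak_conv_m (\<lambda>k. distr M borel (Z k)) L"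

definition two_sample_stat ::
  "real \<Rightarrow> nat \<Rightarrow> (nat \<Rightarrow> 'c) \<Rightarrow> (nat \<Rightarrow> real) \<Rightarrow> (nat \<Rightarrow> real) \<Rightarrow>
   (nat \<Rightarrow> 'w \<Rightarrow> 'c) \<Rightarrow> (nat \<Rightarrow> 'w \<Rightarrow> 'c) \<Rightarrow> nat \<Rightarrow> nat \<Rightarrow> 'w \<Rightarrow> real" where
  "two_sample_stat \<alpha> r c p q X Y n m \<omega> =
     sqrt (real m * real n / (real n * V2 \<alpha> r p q + real m * V1 \<alpha> r p q)) *
     (tsallis \<alpha> r (empirical c X n \<omega>) (empirical c Y m \<omega>) - tsallis \<alpha> r p q)"

text \<open>The sample-size condition \<open>n m / (n + m) \<longlonglongrightarrow> \<gamma>\<close> with \<open>\<gamma> < 1\<close> is incompatible with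
  \<open>n, m \<longlonglongrightarrow> \<infinity>\<close>, because \<open>n m / (n + m) \<ge> min n m / 2\<close>. The condition with
  content is that the proportion \<open>n / (n + m)\<close> has a limit in \<open>{0<..<1}\<close> (equivalently
  \<open>m / (n + m)\<close> has one). Both conditions are therefore treated. For the second
  one, the denominator under the root has to be nonzero: for \<open>p = q\<close> both variances
  vanish and the normalising factor is undefined.\<close>

definition harmonic_rate :: "(nat \<Rightarrow> nat) \<Rightarrow> (nat \<Rightarrow> nat) \<Rightarrow> real \<Rightarrow> bool" where
  "harmonic_rate n m \<gamma> \<longleftrightarrow> (\<lambda>k. real (n k) * real (m k) / (real (n k) + real (m k))) \<longlonglongrightarrow> \<gamma>"

definition proportion_rate :: "(nat \<Rightarrow> nat) \<Rightarrow> (nat \<Rightarrow> nat) \<Rightarrow> real \<Rightarrow> bool" where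
  "proportion_rate n m \<gamma> \<longleftrightarrow> (\<lambda>k. real (n k) / (real (n k) + real (m k))) \<longlonglongrightarrow> \<gamma>"

end

theory Submission
  imports Defs
begin

text \<open>All three limit laws are instances of one delta method for \<open>\<Sum>j. f\<^sub>j (p\<^sub>j, q\<^sub>j)\<close>, evaluated at a pair of
  empirical distributions with a common rate \<open>\<tau>\<close>; a one-sample law is the case where \<open>f\<^sub>j\<close> ignores
  one argument. The linear part of the deviation is a sum of two independent normalised iid sums,
  whose characteristic functions converge by the central limit theorem. The linearisation error
  and the error from replacing \<open>\<tau>\<^sup>2 / n\<close> by its limit vanish in probability, because
  second moments of \<open>\<tau> (p^ - p)\<close> and \<open>\<tau> (q^ - q)\<close> stay bounded. Levy's continuity
  theorem then gives convergence in law.\<close>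

subsection \<open>Centred normal laws\<close>

text \<open>An empirical frequency can be 0 or close to 0, where a power with negative exponent is
  neither differentiable nor bounded. Each summand is therefore only required to be Borel and to be
  differentiable at the single point \<open>(p j, q j)\<close>, and its linearisation error is
  measured by a truncated mean instead of a moment. A second obstacle is that the variances can
  vanish, as they do for \<open>p = q\<close>. Characteristic functions absorb this case, because
  \<open>exp (- v * t\<^sup>2 / 2)\<close> still makes sense at \<open>v = 0\<close>. The rate
  \<tau> is left free so that it can be the normalising factor of the two-sample statistic itself:
  the limits of \<open>\<tau>\<^sup>2 / n\<close> and \<open>\<tau>\<^sup>2 / m\<close> are the
  weights of the two variances in the limit, and for that factor the weighted sum is 1.\<close>

lemma real_distribution_centered_normal:
  assumes "v \<ge> 0"
  shows "real_distribution (centered_normal v)"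
proof (cases "v = 0")
  case True
  interpret prob_space "return borel (0::real)"
    by (rule prob_space_return) simp
  show ?thesis
    using True prob_space_axioms
    by (simp add: centered_normal_def real_distribution_def real_distribution_axioms_def)
next
  case False
  interpret prob_space "density lborel (normal_density 0 (sqrt v))"
    using False assms by (intro prob_space_normal_density) simp
  show ?thesis
    using False prob_space_axioms
    by (simp add: centered_normal_def real_distribution_def real_distribution_axioms_def)
qed

text \<open>The point mass at 0 has characteristic function 1, which is the Gaussian formula at
  \<open>v = 0\<close>, so one formula serves both cases. For \<open>v > 0\<close> the law is the
  standard normal scaled by \<open>sqrt v\<close>.\<close>

lemma char_centered_normal:
  assumes "v \<ge> 0"
  shows "char (centered_normal v) t = exp (- v * t\<^sup>2 / 2)"
proof (cases "v = 0")
  case True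
  then show ?thesis
    by (simp add: centered_normal_def char_def integral_return)
next
  case False
  define s where "s = sqrt v"
  have s: "s > 0" "s\<^sup>2 = v" using False assms by (auto simp: s_def)
  interpret N: prob_space std_normal_distribution
    by (rule prob_space_normal_density) simp
  have "distributed std_normal_distribution lborel (\<lambda>x. x) std_normal_density"
    by (auto simp: distributed_def distr_id2)
  then have "distributed std_normal_distribution lborel (\<lambda>x. 0 + s * x)
      (normal_density (0 + s * 0) (\<bar>s\<bar> * 1))"
    using s(1) by (intro N.normal_density_affine) auto
  then have "centered_normal v = distr std_normal_distribution borel (\<lambda>x. s * x)"
    using False s by (simp add: distributed_def centered_normal_def s_def cong: distr_cong)
  then have "char (centered_normal v) t = char std_normal_distribution (t * s)"
    by (simp add: char_def integral_distr mult_ac)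
  also have "\<dots> = exp (- v * t\<^sup>2 / 2)"
    by (simp add: char_std_normal_distribution power_mult_distrib s(2) mult_ac)
  finally show ?thesis .
qed

subsection \<open>Convergence in probability and characteristic functions\<close>

context prob_space
begin

text \<open>Convergence \<open>R k \<longlonglongrightarrow> 0\<close> in probability is expressed below by \<open>expectation (\<lambda>x. min 1 \<bar>R k x\<bar>) \<longlonglongrightarrow> 0\<close>:
  the integrand is bounded, so no moments of \<open>R\<close> are needed.\<close>

lemma integrable_min_1:
  fixes R :: "'a \<Rightarrow> real"
  assumes "R \<in> borel_measurable M"
  shows "integrable M (\<lambda>x. min 1 \<bar>R x\<bar>)"
  using assms by (intro integrable_const_bound[where B = 1]) auto

lemma le_min_1_mult:
  fixes z t d :: real
  assumes "z \<le> \<bar>t * d\<bar>" "z \<le> 2"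
  shows "z \<le> (2 + \<bar>t\<bar>) * min 1 \<bar>d\<bar>"
proof (cases "1 \<le> \<bar>d\<bar>")
  case False
  have "\<bar>t * d\<bar> \<le> (2 + \<bar>t\<bar>) * \<bar>d\<bar>" by (simp add: abs_mult mult_right_mono)
  with False assms show ?thesis by simp
qed (use assms in simp)

text \<open>After a factor of modulus 1 is pulled out, the integrand is
  \<open>cmod (iexp (t * d) - 1)\<close> with \<open>d = Z x - L x\<close>. It is at most
  \<open>\<bar>t * d\<bar>\<close> and at most 2, and \<open>2 + \<bar>t\<bar>\<close> is a constant
  that covers both bounds.\<close>

lemma char_distr_diff_le:
  fixes Z L :: "'a \<Rightarrow> real"
  assumes [measurable]: "Z \<in> borel_measurable M" "L \<in> borel_measurable M"
  shows "cmod (char (distr M borel Z) t - char (distr M borel L) t)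
    \<le> (2 + \<bar>t\<bar>) * expectation (\<lambda>x. min 1 \<bar>Z x - L x\<bar>)"
proof -
  have i: "integrable M (\<lambda>x. iexp (t * Z x))" "integrable M (\<lambda>x. iexp (t * L x))"
    by (intro integrable_const_bound[where B = 1]; simp)+
  have "cmod (iexp (t * Z x) - iexp (t * L x)) \<le> (2 + \<bar>t\<bar>) * min 1 \<bar>Z x - L x\<bar>" for x
  proof -
    have "iexp (t * Z x) - iexp (t * L x) = iexp (t * L x) * (iexp (t * (Z x - L x)) - 1)"
      by (simp add: algebra_simps flip: exp_add)
    then have *: "cmod (iexp (t * Z x) - iexp (t * L x)) = cmod (iexp (t * (Z x - L x)) - 1)"
      by (simp add: norm_mult del: of_real_mult of_real_diff)
    have "cmod (iexp (t * (Z x - L x)) - 1) \<le> \<bar>t * (Z x - L x)\<bar>"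
      using iexp_approx1[of "t * (Z x - L x)" 0] by simp
    moreover have "cmod (iexp (t * (Z x - L x)) - 1) \<le> 2"
      using norm_triangle_ineq4[of "iexp (t * (Z x - L x))" 1]
      by (simp del: of_real_mult of_real_diff)
    ultimately show ?thesis
      unfolding * by (rule le_min_1_mult)
  qed
  then have "(\<integral>x. cmod (iexp (t * Z x) - iexp (t * L x)) \<partial>M)
      \<le> (\<integral>x. (2 + \<bar>t\<bar>) * min 1 \<bar>Z x - L x\<bar> \<partial>M)"
    using i by (intro integral_mono integrable_mult_right integrable_min_1 integrable_norm
        Bochner_Integration.integrable_diff) auto
  with integral_norm_bound
  have "cmod (\<integral>x. iexp (t * Z x) - iexp (t * L x) \<partial>M) \<le> (\<integral>x. (2 + \<bar>t\<bar>) * min 1 \<bar>Z x - L x\<bar> \<partial>M)"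
    by (rule order_trans)
  then show ?thesis
    using i by (simp add: char_def integral_distr)
qed

text \<open>This is Slutsky's theorem at the level of characteristic functions: an error that
  vanishes in probability does not change the pointwise limit.\<close>

lemma char_distr_tendsto_cong:
  fixes Z L :: "nat \<Rightarrow> 'a \<Rightarrow> real"
  assumes "\<And>k. Z k \<in> borel_measurable M" "\<And>k. L k \<in> borel_measurable M"
    and "(\<lambda>k. expectation (\<lambda>x. min 1 \<bar>Z k x - L k x\<bar>)) \<longlonglongrightarrow> 0"
    and "(\<lambda>k. char (distr M borel (L k)) t) \<longlonglongrightarrow> \<phi>"
  shows "(\<lambda>k. char (distr M borel (Z k)) t) \<longlonglongrightarrow> \<phi>"
proof -
  have "(\<lambda>k. char (distr M borel (Z k)) t - char (distr M borel (L k)) t) \<longlonglongrightarrow> 0"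
  proof (rule Lim_null_comparison)
    show "(\<lambda>k. (2 + \<bar>t\<bar>) * expectation (\<lambda>x. min 1 \<bar>Z k x - L k x\<bar>)) \<longlonglongrightarrow> 0"
      using tendsto_mult[OF tendsto_const assms(3)] by simp
  qed (use assms(1,2) in \<open>auto intro!: always_eventually char_distr_diff_le\<close>)
  from tendsto_add[OF this assms(4)] show ?thesis by simp
qed

lemma converges_in_law_centered_normalI:
  assumes "\<And>k. Z k \<in> borel_measurable M" "v \<ge> 0"
    and "\<And>t. (\<lambda>k. char (distr M borel (Z k)) t) \<longlonglongrightarrow> exp (- v * t\<^sup>2 / 2)"
  shows "converges_in_law M Z (centered_normal v)"
  unfolding converges_in_law_def using assms
  by (intro levy_continuity real_distribution_distr real_distribution_centered_normal)
    (auto simp: char_centered_normal)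

text \<open>Nonnegativity of the variance gives
  \<open>(E min 1 \<bar>R\<bar>)\<^sup>2 \<le> E R\<^sup>2\<close>. Integrability is asked only
  eventually, since the moment formulas for empirical frequencies are proved for positive sample
  sizes and the first few sizes may be 0.\<close>

lemma expectation_min_1_L2:
  fixes R :: "nat \<Rightarrow> 'a \<Rightarrow> real"
  assumes [measurable]: "\<And>k. R k \<in> borel_measurable M"
    and int: "\<forall>\<^sub>F k in sequentially. integrable M (\<lambda>x. (R k x)\<^sup>2)"
    and lim: "(\<lambda>k. expectation (\<lambda>x. (R k x)\<^sup>2)) \<longlonglongrightarrow> 0"
  shows "(\<lambda>k. expectation (\<lambda>x. min 1 \<bar>R k x\<bar>)) \<longlonglongrightarrow> 0"
proof (rule Lim_null_comparison)
  show "\<forall>\<^sub>F k in sequentially. norm (expectation (\<lambda>x. min 1 \<bar>R k x\<bar>))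
      \<le> sqrt (expectation (\<lambda>x. (R k x)\<^sup>2))"
    using int
  proof eventually_elim
    case (elim k)
    have "0 \<le> variance (\<lambda>x. min 1 \<bar>R k x\<bar>)" by (rule variance_positive)
    moreover have i: "integrable M (\<lambda>x. (min 1 \<bar>R k x\<bar>)\<^sup>2)"
      by (intro integrable_const_bound[where B = 1]) (auto simp: power_le_one)
    ultimately have "(expectation (\<lambda>x. min 1 \<bar>R k x\<bar>))\<^sup>2 \<le> expectation (\<lambda>x. (min 1 \<bar>R k x\<bar>)\<^sup>2)"
      using integrable_min_1[of "R k"] by (subst (asm) variance_eq) auto
    also have "\<dots> \<le> expectation (\<lambda>x. (R k x)\<^sup>2)"
    proof (rule integral_mono[OF i elim])
      show "(min 1 \<bar>R k x\<bar>)\<^sup>2 \<le> (R k x)\<^sup>2" for x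
        using power_mono[of "min 1 \<bar>R k x\<bar>" "\<bar>R k x\<bar>" 2] by simp
    qed
    finally show ?case
      using real_le_rsqrt[of "\<bar>expectation (\<lambda>x. min 1 \<bar>R k x\<bar>)\<bar>"] by simp
  qed
  show "(\<lambda>k. sqrt (expectation (\<lambda>x. (R k x)\<^sup>2))) \<longlonglongrightarrow> 0"
    using tendsto_real_sqrt[OF lim] by simp
qed

lemma expectation_min_1_add:
  fixes R S :: "nat \<Rightarrow> 'a \<Rightarrow> real"
  assumes [measurable]: "\<And>k. R k \<in> borel_measurable M" "\<And>k. S k \<in> borel_measurable M"
    and lim: "(\<lambda>k. expectation (\<lambda>x. min 1 \<bar>R k x\<bar>)) \<longlonglongrightarrow> 0"
      "(\<lambda>k. expectation (\<lambda>x. min 1 \<bar>S k x\<bar>)) \<longlonglongrightarrow> 0"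
  shows "(\<lambda>k. expectation (\<lambda>x. min 1 \<bar>R k x + S k x\<bar>)) \<longlonglongrightarrow> 0"
proof (rule Lim_null_comparison)
  show "(\<lambda>k. expectation (\<lambda>x. min 1 \<bar>R k x\<bar>) + expectation (\<lambda>x. min 1 \<bar>S k x\<bar>)) \<longlonglongrightarrow> 0"
    using tendsto_add[OF lim] by simp
  have "expectation (\<lambda>x. min 1 \<bar>R k x + S k x\<bar>)
      \<le> expectation (\<lambda>x. min 1 \<bar>R k x\<bar> + min 1 \<bar>S k x\<bar>)" for k
    by (intro integral_mono Bochner_Integration.integrable_add integrable_min_1) auto
  then have "expectation (\<lambda>x. min 1 \<bar>R k x + S k x\<bar>)
      \<le> expectation (\<lambda>x. min 1 \<bar>R k x\<bar>) + expectation (\<lambda>x. min 1 \<bar>S k x\<bar>)" for k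
    by (simp add: integrable_min_1)
  then show "\<forall>\<^sub>F k in sequentially. norm (expectation (\<lambda>x. min 1 \<bar>R k x + S k x\<bar>))
      \<le> expectation (\<lambda>x. min 1 \<bar>R k x\<bar>) + expectation (\<lambda>x. min 1 \<bar>S k x\<bar>)"
    by simp
qed

lemma expectation_min_1_sum:
  fixes R :: "'j \<Rightarrow> nat \<Rightarrow> 'a \<Rightarrow> real"
  assumes "finite J" "\<And>j k. j \<in> J \<Longrightarrow> R j k \<in> borel_measurable M"
    and "\<And>j. j \<in> J \<Longrightarrow> (\<lambda>k. expectation (\<lambda>x. min 1 \<bar>R j k x\<bar>)) \<longlonglongrightarrow> 0"
  shows "(\<lambda>k. expectation (\<lambda>x. min 1 \<bar>\<Sum>j\<in>J. R j k x\<bar>)) \<longlonglongrightarrow> 0"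
  using assms
proof (induction J rule: finite_induct)
  case (insert j J)
  have "(\<lambda>k. expectation (\<lambda>x. min 1 \<bar>R j k x + (\<Sum>j\<in>J. R j k x)\<bar>)) \<longlonglongrightarrow> 0"
    using insert by (intro expectation_min_1_add borel_measurable_sum) auto
  with insert show ?case by simp
qed simp

text \<open>If \<open>D = norm (W - w) < d\<close>, the linearisation error is at most \<open>e \<tau> D \<le> e (1 + \<tau>\<^sup>2 D\<^sup>2)\<close>; otherwise the
  truncation bounds it by \<open>1 \<le> D\<^sup>2 / d\<^sup>2\<close>.\<close>

lemma delta_remainder:
  fixes f :: "'b::euclidean_space \<Rightarrow> real" and W :: "nat \<Rightarrow> 'a \<Rightarrow> 'b"
  assumes f: "(f has_derivative f') (at w)"
    and [measurable]: "f \<in> borel_measurable borel" "\<And>k. W k \<in> borel_measurable M"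
    and int: "\<forall>\<^sub>F k in sequentially. integrable M (\<lambda>x. (norm (W k x - w))\<^sup>2)"
    and lim: "(\<lambda>k. expectation (\<lambda>x. (norm (W k x - w))\<^sup>2)) \<longlonglongrightarrow> 0"
    and bdd: "\<forall>\<^sub>F k in sequentially. (\<tau> k)\<^sup>2 * expectation (\<lambda>x. (norm (W k x - w))\<^sup>2) \<le> C"
  shows "(\<lambda>k. expectation (\<lambda>x. min 1 \<bar>\<tau> k * (f (W k x) - f w - f' (W k x - w))\<bar>)) \<longlonglongrightarrow> 0"
proof (rule LIMSEQ_I)
  fix \<epsilon> :: real assume "\<epsilon> > 0"
  have [measurable]: "f' \<in> borel_measurable borel"
    using f by (intro borel_measurable_continuous_onI linear_continuous_on) (rule has_derivative_bounded_linear)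
  define D where "D k x = norm (W k x - w)" for k x
  \<comment> \<open>With \<open>2 + \<bar>C\<bar>\<close> the denominator is positive whatever the
    sign of \<open>C\<close>, and it strictly exceeds \<open>1 + C\<close>. This leaves the other
    half of \<epsilon> for the event \<open>D \<ge> d\<close>.\<close>
  define e where "e = \<epsilon> / (2 * (2 + \<bar>C\<bar>))"
  have e: "e > 0" "e * (1 + C) < \<epsilon> / 2"
  proof -
    have "\<epsilon> * (1 + C) < \<epsilon> * (2 + \<bar>C\<bar>)"
      using \<open>\<epsilon> > 0\<close> by (intro mult_strict_left_mono) auto
    then show "e > 0" "e * (1 + C) < \<epsilon> / 2"
      using \<open>\<epsilon> > 0\<close> by (auto simp: e_def field_simps)
  qed
  obtain d where d: "d > 0" "\<And>y. norm (y - w) < d \<Longrightarrow> \<bar>f y - f w - f' (y - w)\<bar> \<le> e * norm (y - w)"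
    using f e(1) unfolding has_derivative_at_alt real_norm_def by blast
  have pt: "min 1 \<bar>\<tau> k * (f (W k x) - f w - f' (W k x - w))\<bar>
      \<le> e * (1 + (\<tau> k)\<^sup>2 * (D k x)\<^sup>2) + (D k x)\<^sup>2 / d\<^sup>2" for k x
  proof (cases "D k x < d")
    case True
    have "\<bar>\<tau> k * (f (W k x) - f w - f' (W k x - w))\<bar> \<le> \<bar>\<tau> k\<bar> * (e * D k x)"
      unfolding abs_mult D_def using True by (intro mult_left_mono d) (auto simp: D_def)
    also have "\<dots> = e * (\<bar>\<tau> k\<bar> * D k x)" by simp
    also have "\<dots> \<le> e * (1 + (\<tau> k)\<^sup>2 * (D k x)\<^sup>2)"
    proof (intro mult_left_mono)
      \<comment> \<open>This trades the first power of \<open>\<bar>\<tau>\<bar> * D\<close> for its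
        square, the only quantity whose mean is bounded by hypothesis.\<close>
      have "u \<le> 1 + u\<^sup>2" for u :: real
        using zero_le_power2[of "u - 1 / 2"] by (simp add: power2_diff power_divide)
      from this[of "\<bar>\<tau> k\<bar> * D k x"]
      show "\<bar>\<tau> k\<bar> * D k x \<le> 1 + (\<tau> k)\<^sup>2 * (D k x)\<^sup>2"
        by (simp add: power_mult_distrib)
    qed (use e in auto)
    finally show ?thesis
      by (intro min.coboundedI2 add_increasing2) auto
  next
    case False
    then have "1 \<le> (D k x)\<^sup>2 / d\<^sup>2" using d(1) by (auto intro!: power_mono)
    moreover have "0 \<le> e * (1 + (\<tau> k)\<^sup>2 * (D k x)\<^sup>2)" using e(1) by simp
    ultimately show ?thesis by linarith
  qed
  have "\<forall>\<^sub>F k in sequentially. expectation (\<lambda>x. (D k x)\<^sup>2) < \<epsilon> / 2 * d\<^sup>2"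
    unfolding D_def using lim \<open>\<epsilon> > 0\<close> d(1) by (intro order_tendstoD(2)[OF lim]) auto
  with int bdd have "\<forall>\<^sub>F k in sequentially.
      expectation (\<lambda>x. min 1 \<bar>\<tau> k * (f (W k x) - f w - f' (W k x - w))\<bar>) < \<epsilon>"
  proof eventually_elim
    case (elim k)
    have i: "integrable M (\<lambda>x. (D k x)\<^sup>2)" using elim by (simp add: D_def)
    have "expectation (\<lambda>x. min 1 \<bar>\<tau> k * (f (W k x) - f w - f' (W k x - w))\<bar>)
        \<le> expectation (\<lambda>x. e * (1 + (\<tau> k)\<^sup>2 * (D k x)\<^sup>2) + (D k x)\<^sup>2 / d\<^sup>2)"
      using i by (intro integral_mono pt integrable_min_1) auto
    also have "\<dots> = e * (1 + (\<tau> k)\<^sup>2 * expectation (\<lambda>x. (D k x)\<^sup>2)) + expectation (\<lambda>x. (D k x)\<^sup>2) / d\<^sup>2"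
      using i by (simp add: prob_space)
    also have "\<dots> < e * (1 + C) + \<epsilon> / 2"
      using elim e(1) d(1)
      by (intro add_le_less_mono mult_left_mono) (auto simp: D_def field_simps)
    finally show ?case using e by simp
  qed
  then show "\<exists>N. \<forall>k\<ge>N. norm (expectation (\<lambda>x. min 1 \<bar>\<tau> k * (f (W k x) - f w - f' (W k x - w))\<bar>) - 0) < \<epsilon>"
    by (simp add: eventually_sequentially)
qed

subsection \<open>Sums of independent variables\<close>

lemma indep_vars_reindex:
  fixes h :: "'i \<Rightarrow> 'j"
  assumes "inj_on h I" "indep_vars N X (h ` I)"
  shows "indep_vars (\<lambda>i. N (h i)) (\<lambda>i. X (h i)) I"
proof -
  have "indep_sets (\<lambda>i. F (h i)) I" if F: "indep_sets F (h ` I)" for F :: "'j \<Rightarrow> 'a set set"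
    unfolding indep_sets_def
  proof (intro conjI ballI allI impI)
    show "F (h i) \<subseteq> events" if "i \<in> I" for i
      using F that by (auto simp: indep_sets_def)
    fix J A assume J: "J \<subseteq> I" "J \<noteq> {}" "finite J" and A: "A \<in> (\<Pi> i\<in>J. F (h i))"
    have inj: "inj_on h J" using assms(1) J(1) by (rule inj_on_subset)
    define B where "B = A \<circ> the_inv_into J h"
    have B: "B (h j) = A j" if "j \<in> J" for j
      using that inj by (simp add: B_def the_inv_into_f_f)
    have "prob (\<Inter>j\<in>h ` J. B j) = (\<Prod>j\<in>h ` J. prob (B j))"
      using J A B by (intro indep_setsD[OF F]) auto
    then show "prob (\<Inter>j\<in>J. A j) = (\<Prod>j\<in>J. prob (A j))"
      using B inj by (simp add: prod.reindex)
  qed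
  from this[of "\<lambda>i. {X i -` A \<inter> space M |A. A \<in> sets (N i)}"] show ?thesis
    using assms(2) unfolding indep_vars_def2 by auto
qed

text \<open>Centred independent variables are orthogonal: each induction step adds a variable
  independent of the partial sum, so the cross term is integrable with mean 0.\<close>

lemma second_moment_indep_sum:
  fixes \<xi> :: "'i \<Rightarrow> 'a \<Rightarrow> real"
  assumes "finite I" "indep_vars (\<lambda>_. borel) \<xi> I"
    and "\<And>i. i \<in> I \<Longrightarrow> integrable M (\<lambda>x. (\<xi> i x)\<^sup>2)" "\<And>i. i \<in> I \<Longrightarrow> expectation (\<xi> i) = 0"
  shows "integrable M (\<lambda>x. (\<Sum>i\<in>I. \<xi> i x)\<^sup>2)"
    and "expectation (\<lambda>x. (\<Sum>i\<in>I. \<xi> i x)\<^sup>2) = (\<Sum>i\<in>I. expectation (\<lambda>x. (\<xi> i x)\<^sup>2))"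
proof -
  have "integrable M (\<lambda>x. (\<Sum>i\<in>I. \<xi> i x)\<^sup>2) \<and>
      expectation (\<lambda>x. (\<Sum>i\<in>I. \<xi> i x)\<^sup>2) = (\<Sum>i\<in>I. expectation (\<lambda>x. (\<xi> i x)\<^sup>2))"
    using assms
  proof (induction I rule: finite_induct)
    case (insert i I)
    have rv [measurable]: "\<xi> k \<in> borel_measurable M" if "k \<in> insert i I" for k
      using insert.prems(1) that unfolding indep_vars_def by auto
    define S where "S x = (\<Sum>k\<in>I. \<xi> k x)" for x
    have [measurable]: "\<xi> i \<in> borel_measurable M" "S \<in> borel_measurable M"
      unfolding S_def by (auto intro!: borel_measurable_sum rv)
    have IH: "integrable M (\<lambda>x. (S x)\<^sup>2)"
        "expectation (\<lambda>x. (S x)\<^sup>2) = (\<Sum>i\<in>I. expectation (\<lambda>x. (\<xi> i x)\<^sup>2))"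
      using insert.IH insert.prems indep_vars_subset[OF insert.prems(1), of I]
      by (auto simp: S_def)
    have ind: "indep_var borel (\<xi> i) borel S"
      unfolding S_def using insert by (intro indep_vars_sum) auto
    have i: "integrable M (\<xi> i)" "integrable M S"
      using insert.prems(2) IH by (auto intro: square_integrable_imp_integrable)
    have "integrable M (\<lambda>x. \<xi> i x * S x)" "expectation (\<lambda>x. \<xi> i x * S x) = 0"
      using indep_var_integrable[OF ind i] indep_var_lebesgue_integral[OF ind i] insert.prems(3)
      by auto
    moreover have "(\<xi> i x + S x)\<^sup>2 = (\<xi> i x)\<^sup>2 + (2 * (\<xi> i x * S x) + (S x)\<^sup>2)" for x
      by (simp add: power2_sum)
    ultimately show ?case
      using insert IH by (simp add: S_def[symmetric])
  qed simp
  then show "integrable M (\<lambda>x. (\<Sum>i\<in>I. \<xi> i x)\<^sup>2)"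
    and "expectation (\<lambda>x. (\<Sum>i\<in>I. \<xi> i x)\<^sup>2) = (\<Sum>i\<in>I. expectation (\<lambda>x. (\<xi> i x)\<^sup>2))" by auto
qed

text \<open>Dividing by \<open>sqrt n\<close> alone keeps \<open>v = 0\<close> meaningful; there
  every summand vanishes almost surely. For \<open>v > 0\<close> the standard limit is evaluated at
  \<open>t * sqrt v\<close>.\<close>

lemma char_normalized_sum_tendsto:
  fixes \<xi> :: "nat \<Rightarrow> 'a \<Rightarrow> real"
  assumes indep: "indep_vars (\<lambda>_. borel) \<xi> UNIV"
    and mean: "\<And>i. expectation (\<xi> i) = 0" and int: "\<And>i. integrable M (\<lambda>x. (\<xi> i x)\<^sup>2)"
    and var: "\<And>i. expectation (\<lambda>x. (\<xi> i x)\<^sup>2) = v" and distr: "\<And>i. distr M borel (\<xi> i) = \<mu>"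
  shows "(\<lambda>n. char (distr M borel (\<lambda>x. (\<Sum>i<n. \<xi> i x) / sqrt (real n))) t) \<longlonglongrightarrow> exp (- v * t\<^sup>2 / 2)"
proof -
  have [measurable]: "\<xi> i \<in> borel_measurable M" for i
    using indep unfolding indep_vars_def by auto
  have "v \<ge> 0" unfolding var[of 0, symmetric] by simp
  show ?thesis
  proof (cases "v = 0")
    case True
    have "AE x in M. \<xi> i x = 0" for i
      using integral_nonneg_eq_0_iff_AE[OF int[of i]] var[of i] True by simp
    then have ae: "AE x in M. \<forall>i. \<xi> i x = 0" by (simp add: AE_all_countable)
    have "char (distr M borel (\<lambda>x. (\<Sum>i<n. \<xi> i x) / sqrt (real n))) t
        = (CLINT x|M. iexp (t * ((\<Sum>i<n. \<xi> i x) / sqrt (real n))))" for n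
      unfolding char_def by (subst integral_distr) auto
    also have "\<dots> n = (CLINT x|M. 1)" for n
      by (rule integral_cong_AE) (use ae in auto)
    finally have "char (distr M borel (\<lambda>x. (\<Sum>i<n. \<xi> i x) / sqrt (real n))) t = (CLINT x|M. 1)" for n .
    then show ?thesis using True by (simp add: prob_space)
  next
    case False
    with \<open>v \<ge> 0\<close> have v: "sqrt v > 0" by simp
    have "weak_conv_m (\<lambda>n. distr M borel (\<lambda>x. (\<Sum>i<n. \<xi> i x) / sqrt (real n * (sqrt v)\<^sup>2)))
        std_normal_distribution"
      using v mean int var by (intro central_limit_theorem_zero_mean[OF indep _ _ _ _ distr]) auto
    then have "(\<lambda>n. char (distr M borel (\<lambda>x. (\<Sum>i<n. \<xi> i x) / sqrt (real n * (sqrt v)\<^sup>2))) (t * sqrt v))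
        \<longlonglongrightarrow> char std_normal_distribution (t * sqrt v)"
      by (intro levy_continuity1 real_distribution_distr real_dist_normal_dist) auto
    moreover have "char (distr M borel (\<lambda>x. (\<Sum>i<n. \<xi> i x) / sqrt (real n * (sqrt v)\<^sup>2))) (t * sqrt v)
      = char (distr M borel (\<lambda>x. (\<Sum>i<n. \<xi> i x) / sqrt (real n))) t" for n
      using v \<open>v \<ge> 0\<close> by (simp add: char_def integral_distr real_sqrt_mult)
    ultimately show ?thesis
      using \<open>v \<ge> 0\<close> by (simp add: char_std_normal_distribution power_mult_distrib mult_ac)
  qed
qed

end

subsection \<open>Linear statistics of an iid sample\<close>

text \<open>For injective \<open>c\<close> this is the function \<open>c j \<mapsto> a j\<close> on
  the alphabet. The form as a sum of indicators makes its mean linear in the letter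
  probabilities.\<close>

definition letter_value :: "nat \<Rightarrow> (nat \<Rightarrow> 'c) \<Rightarrow> (nat \<Rightarrow> real) \<Rightarrow> 'c \<Rightarrow> real" where
  "letter_value r c a x = (\<Sum>j\<in>{1..r}. a j * of_bool (x = c j))"

text \<open>This is the quadratic form of the multinomial covariance \<open>diag p - p p^T\<close>
  at the vector \<open>a\<close>, that is, the variance of \<open>letter_value\<close> at a letter
  with law \<open>p\<close>.\<close>

definition letter_var :: "nat \<Rightarrow> (nat \<Rightarrow> real) \<Rightarrow> (nat \<Rightarrow> real) \<Rightarrow> real" where
  "letter_var r p a = (\<Sum>j\<in>{1..r}. (a j)\<^sup>2 * p j) - (\<Sum>j\<in>{1..r}. a j * p j)\<^sup>2"

definition linear_dev ::
  "nat \<Rightarrow> (nat \<Rightarrow> 'c) \<Rightarrow> (nat \<Rightarrow> real) \<Rightarrow> (nat \<Rightarrow> 'w \<Rightarrow> 'c) \<Rightarrow> (nat \<Rightarrow> real) \<Rightarrow> nat \<Rightarrow> 'w \<Rightarrow> real" where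
  "linear_dev r c p X a n \<omega> = (\<Sum>j\<in>{1..r}. a j * (empirical c X n \<omega> j - p j))"

lemma sum_square_distinct_pairs:
  "(\<Sum>j\<in>{1..r}. x j)\<^sup>2 = (\<Sum>j\<in>{1..r}. (x j)\<^sup>2) + 2 * (\<Sum>(i, j)\<in>distinct_pairs r. x i * x j :: real)"
proof (induction r)
  case (Suc r)
  have fin: "finite (distinct_pairs r)"
    by (rule finite_subset[of _ "{1..r} \<times> {1..r}"]) (auto simp: distinct_pairs_def)
  have split: "distinct_pairs (Suc r) = distinct_pairs r \<union> (\<lambda>i. (i, Suc r)) ` {1..r}"
    by (auto simp: distinct_pairs_def)
  have disj: "distinct_pairs r \<inter> (\<lambda>i. (i, Suc r)) ` {1..r} = {}"
    by (auto simp: distinct_pairs_def)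
  have "(\<Sum>(i, j)\<in>(\<lambda>i. (i, Suc r)) ` {1..r}. x i * x j) = (\<Sum>i\<in>{1..r}. x i) * x (Suc r)"
    by (subst sum.reindex) (auto simp: inj_on_def sum_distrib_right)
  then have "(\<Sum>(i, j)\<in>distinct_pairs (Suc r). x i * x j)
      = (\<Sum>(i, j)\<in>distinct_pairs r. x i * x j) + (\<Sum>i\<in>{1..r}. x i) * x (Suc r)"
    unfolding split using fin disj by (subst sum.union_disjoint) simp_all
  moreover have "(\<Sum>j\<in>{1..Suc r}. x j)\<^sup>2
      = (\<Sum>j\<in>{1..r}. x j)\<^sup>2 + (x (Suc r))\<^sup>2 + 2 * (\<Sum>j\<in>{1..r}. x j) * x (Suc r)"
    by (simp add: power2_sum)
  ultimately show ?case
    using Suc.IH by (simp add: distrib_left mult.assoc)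
qed (simp add: distinct_pairs_def)

text \<open>Expanding the square of the mean moves its diagonal terms into
  \<open>p j * (1 - p j)\<close> and leaves the off-diagonal ones as a sum over unordered pairs.
  This is the shape of \<open>V1\<close> and \<open>V2\<close>.\<close>

lemma letter_var_eq:
  "letter_var r p a = (\<Sum>j\<in>{1..r}. p j * (1 - p j) * (a j)\<^sup>2)
    - 2 * (\<Sum>(i, j)\<in>distinct_pairs r. p i * p j * a i * a j)"
proof -
  have "(\<Sum>j\<in>{1..r}. p j * (1 - p j) * (a j)\<^sup>2)
      = (\<Sum>j\<in>{1..r}. (a j)\<^sup>2 * p j) - (\<Sum>j\<in>{1..r}. (a j * p j)\<^sup>2)"
    by (simp add: power2_eq_square algebra_simps sum_subtractf)
  then show ?thesis
    unfolding letter_var_def sum_square_distinct_pairs[of "\<lambda>j. a j * p j"]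
    by (simp add: mult_ac)
qed

lemma letter_value_measurable [measurable]:
  "letter_value r c a \<in> borel_measurable (alphabet r c)"
  by (simp add: alphabet_def)

text \<open>At most one indicator in the sum is nonzero, so squaring acts on the coefficients.
  Second moments of letter values thereby reduce to first moments.\<close>

lemma letter_value_square:
  assumes "inj_on c {1..r}"
  shows "(letter_value r c a x)\<^sup>2 = letter_value r c (\<lambda>j. (a j)\<^sup>2) x"
proof (cases "x \<in> c ` {1..r}")
  case True
  then obtain l where l: "l \<in> {1..r}" "x = c l" by auto
  have "letter_value r c b x = b l" for b
  proof -
    have "letter_value r c b x = (\<Sum>j\<in>{1..r}. if j = l then b l else 0)"
      unfolding letter_value_def
      using l assms by (intro sum.cong) (auto simp: inj_on_eq_iff)
    then show ?thesis using l by simp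
  qed
  then show ?thesis by simp
next
  case False
  then have "letter_value r c b x = 0" for b
    unfolding letter_value_def by (intro sum.neutral) auto
  then show ?thesis by simp
qed

text \<open>Exchanging the sum over letters with the sum over observations exhibits a linear
  functional of the empirical distribution as an average of centred iid terms.\<close>

lemma linear_dev_eq:
  assumes "n > 0"
  shows "linear_dev r c p X a n \<omega>
    = (\<Sum>i<n. letter_value r c a (X (Suc i) \<omega>) - (\<Sum>j\<in>{1..r}. a j * p j)) / real n"
proof -
  have "(\<Sum>j\<in>{1..r}. a j * empirical c X n \<omega> j)
      = (\<Sum>j\<in>{1..r}. \<Sum>i<n. a j * of_bool (X (Suc i) \<omega> = c j)) / real n"
    by (simp add: empirical_def sum.atLeast1_atMost_eq[of _ n] sum_divide_distrib sum_distrib_left mult_ac)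
  also have "(\<Sum>j\<in>{1..r}. \<Sum>i<n. a j * of_bool (X (Suc i) \<omega> = c j))
      = (\<Sum>i<n. letter_value r c a (X (Suc i) \<omega>))"
    unfolding letter_value_def by (rule sum.swap)
  finally show ?thesis
    using assms unfolding linear_dev_def right_diff_distrib sum_subtractf diff_divide_distrib
    by simp
qed

context prob_space
begin

context
  fixes r :: nat and c :: "nat \<Rightarrow> 'c" and p :: "nat \<Rightarrow> real" and X :: "nat \<Rightarrow> 'a \<Rightarrow> 'c"
  assumes iid: "iid_sample M r c p X"
begin

lemma sample_measurable: "i \<ge> 1 \<Longrightarrow> X i \<in> measurable M (alphabet r c)"
  using iid unfolding iid_sample_def indep_vars_def by auto

lemma empirical_measurable:
  assumes "j \<in> {1..r}"
  shows "(\<lambda>\<omega>. empirical c X n \<omega> j) \<in> borel_measurable M"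
proof -
  have "(\<lambda>\<omega>. of_bool (X i \<omega> = c j) :: real) \<in> borel_measurable M" if "i \<ge> 1" for i
    using measurable_compose[OF sample_measurable[OF that], of "\<lambda>x. of_bool (x = c j)" borel]
    by (simp add: alphabet_def)
  then show ?thesis
    unfolding empirical_def by (intro borel_measurable_times borel_measurable_sum) auto
qed

lemma linear_dev_measurable: "linear_dev r c p X a n \<in> borel_measurable M"
  unfolding linear_dev_def
  by (intro borel_measurable_sum borel_measurable_times borel_measurable_diff empirical_measurable) auto

lemma
  assumes "i \<ge> 1"
  shows integrable_letter_value: "integrable M (\<lambda>\<omega>. letter_value r c a (X i \<omega>))"
    and expectation_letter_value:
      "expectation (\<lambda>\<omega>. letter_value r c a (X i \<omega>)) = (\<Sum>j\<in>{1..r}. a j * p j)"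
proof -
  define E where "E j = {\<omega> \<in> space M. X i \<omega> = c j}" for j
  have E: "E j \<in> sets M" if "j \<in> {1..r}" for j
    using measurable_sets[OF sample_measurable[OF assms], of "{c j}"] that
    by (auto simp: E_def alphabet_def vimage_def Collect_conj_eq Int_commute)
  have eq: "letter_value r c a (X i \<omega>) = (\<Sum>j\<in>{1..r}. a j * indicator (E j) \<omega>)"
    if "\<omega> \<in> space M" for \<omega>
    using that by (auto simp: letter_value_def E_def indicator_def intro!: sum.cong)
  have "integrable M (\<lambda>\<omega>. \<Sum>j\<in>{1..r}. a j * indicator (E j) \<omega>)"
    using E by (intro Bochner_Integration.integrable_sum integrable_mult_right)
      (auto simp: integrable_indicator_iff less_top[symmetric])
  then show "integrable M (\<lambda>\<omega>. letter_value r c a (X i \<omega>))"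
    by (simp add: eq cong: Bochner_Integration.integrable_cong)
  have "expectation (\<lambda>\<omega>. letter_value r c a (X i \<omega>))
      = expectation (\<lambda>\<omega>. \<Sum>j\<in>{1..r}. a j * indicator (E j) \<omega>)"
    by (intro Bochner_Integration.integral_cong eq) auto
  also have "\<dots> = (\<Sum>j\<in>{1..r}. a j * prob (E j))"
    using E by (subst Bochner_Integration.integral_sum)
      (auto simp: integrable_indicator_iff less_top[symmetric])
  also have "\<dots> = (\<Sum>j\<in>{1..r}. a j * p j)"
    using iid assms by (intro sum.cong) (auto simp: E_def iid_sample_def)
  finally show "expectation (\<lambda>\<omega>. letter_value r c a (X i \<omega>)) = (\<Sum>j\<in>{1..r}. a j * p j)" .
qed

text \<open>\<open>iid_sample\<close> fixes only point masses, and these determine a law on a finite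
  alphabet. Equality of laws is what the central limit theorem asks for.\<close>

lemma distr_sample_eq:
  assumes "i \<ge> 1" "k \<ge> 1"
  shows "distr M (alphabet r c) (X i) = distr M (alphabet r c) (X k)"
proof (rule measure_eqI_finite[of _ "c ` {1..r}"])
  fix x assume "x \<in> c ` {1..r}"
  then obtain j where j: "j \<in> {1..r}" "x = c j" by auto
  have "emeasure (distr M (alphabet r c) (X i)) {x} = ennreal (p j)" if "i \<ge> 1" for i
  proof -
    have "emeasure (distr M (alphabet r c) (X i)) {x} = emeasure M (X i -` {x} \<inter> space M)"
      using j by (intro emeasure_distr sample_measurable that) (simp add: alphabet_def)
    also have "X i -` {x} \<inter> space M = {\<omega> \<in> space M. X i \<omega> = c j}"
      using j by auto
    finally show ?thesis
      using iid j that by (simp add: emeasure_eq_measure iid_sample_def)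
  qed
  with assms show "emeasure (distr M (alphabet r c) (X i)) {x} = emeasure (distr M (alphabet r c) (X k)) {x}"
    by simp
qed (auto simp: alphabet_def)

context
  assumes inj: "inj_on c {1..r}"
begin

context
  fixes a :: "nat \<Rightarrow> real" and \<xi> :: "nat \<Rightarrow> 'a \<Rightarrow> real"
  defines "\<xi> \<equiv> \<lambda>i \<omega>. letter_value r c a (X (Suc i) \<omega>) - (\<Sum>j\<in>{1..r}. a j * p j)"
begin

lemma indep_centered_letter_values: "indep_vars (\<lambda>_. borel) \<xi> UNIV"
proof -
  have "indep_vars (\<lambda>_. alphabet r c) (\<lambda>i. X (Suc i)) UNIV"
  proof -
    have "indep_vars (\<lambda>_. alphabet r c) X (range Suc)"
      using iid by (auto simp: iid_sample_def intro: indep_vars_subset[where I = "{1..}"])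
    from indep_vars_reindex[OF _ this] show ?thesis by simp
  qed
  then show ?thesis
    unfolding \<xi>_def
    by (rule indep_vars_compose2[where Y = "\<lambda>_ x. letter_value r c a x - (\<Sum>j\<in>{1..r}. a j * p j)"])
      measurable
qed

lemma expectation_centered_letter_value: "expectation (\<xi> i) = 0"
  by (simp add: \<xi>_def integrable_letter_value expectation_letter_value prob_space)

lemma centered_letter_value_moment2:
  "integrable M (\<lambda>\<omega>. (\<xi> i \<omega>)\<^sup>2)" "expectation (\<lambda>\<omega>. (\<xi> i \<omega>)\<^sup>2) = letter_var r p a"
proof -
  define m where "m = (\<Sum>j\<in>{1..r}. a j * p j)"
  have eq: "(\<xi> i \<omega>)\<^sup>2 = letter_value r c (\<lambda>j. (a j)\<^sup>2) (X (Suc i) \<omega>)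
      - 2 * m * letter_value r c a (X (Suc i) \<omega>) + m\<^sup>2" for \<omega>
    by (simp add: \<xi>_def m_def power2_diff letter_value_square[OF inj])
  note int = integrable_letter_value[of "Suc i"]
  show "integrable M (\<lambda>\<omega>. (\<xi> i \<omega>)\<^sup>2)"
    unfolding eq using int by auto
  have "expectation (\<lambda>\<omega>. (\<xi> i \<omega>)\<^sup>2) = (\<Sum>j\<in>{1..r}. (a j)\<^sup>2 * p j) - 2 * m * m + m\<^sup>2"
    unfolding eq using int by (simp add: expectation_letter_value prob_space m_def)
  then show "expectation (\<lambda>\<omega>. (\<xi> i \<omega>)\<^sup>2) = letter_var r p a"
    by (simp add: letter_var_def m_def power2_eq_square)
qed

lemma distr_centered_letter_value: "distr M borel (\<xi> i) = distr M borel (\<xi> 0)"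
proof -
  define h where "h x = letter_value r c a x - (\<Sum>j\<in>{1..r}. a j * p j)" for x
  have [measurable]: "h \<in> borel_measurable (alphabet r c)"
    unfolding h_def by measurable
  have "distr M borel (\<xi> i) = distr (distr M (alphabet r c) (X (Suc i))) borel h" for i
    by (subst distr_distr) (auto simp: sample_measurable \<xi>_def h_def comp_def)
  with distr_sample_eq[of "Suc i" "Suc 0"] show ?thesis by simp
qed

lemma linear_dev_moment2:
  assumes "n > 0"
  shows "integrable M (\<lambda>\<omega>. (linear_dev r c p X a n \<omega>)\<^sup>2)"
    and "expectation (\<lambda>\<omega>. (linear_dev r c p X a n \<omega>)\<^sup>2) = letter_var r p a / n"
proof -
  have eq: "linear_dev r c p X a n \<omega> = (\<Sum>i<n. \<xi> i \<omega>) / n" for \<omega>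
    using assms by (simp add: linear_dev_eq \<xi>_def)
  note sum = second_moment_indep_sum[of "{..<n}" \<xi>,
      OF _ indep_vars_subset[OF indep_centered_letter_values] centered_letter_value_moment2(1)
        expectation_centered_letter_value]
  show "integrable M (\<lambda>\<omega>. (linear_dev r c p X a n \<omega>)\<^sup>2)"
    unfolding eq power_divide using sum by simp
  show "expectation (\<lambda>\<omega>. (linear_dev r c p X a n \<omega>)\<^sup>2) = letter_var r p a / n"
    unfolding eq power_divide
    using sum assms by (simp add: centered_letter_value_moment2) (simp add: power2_eq_square)
qed

lemma char_linear_dev_tendsto:
  "(\<lambda>n. char (distr M borel (\<lambda>\<omega>. sqrt (real n) * linear_dev r c p X a n \<omega>)) t)
    \<longlonglongrightarrow> exp (- letter_var r p a * t\<^sup>2 / 2)"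
proof (rule Lim_transform_eventually)
  show "(\<lambda>n. char (distr M borel (\<lambda>x. (\<Sum>i<n. \<xi> i x) / sqrt (real n))) t)
      \<longlonglongrightarrow> exp (- letter_var r p a * t\<^sup>2 / 2)"
    by (rule char_normalized_sum_tendsto[OF indep_centered_letter_values
          expectation_centered_letter_value centered_letter_value_moment2 distr_centered_letter_value])
  show "\<forall>\<^sub>F n in sequentially. char (distr M borel (\<lambda>x. (\<Sum>i<n. \<xi> i x) / sqrt (real n))) t
      = char (distr M borel (\<lambda>\<omega>. sqrt (real n) * linear_dev r c p X a n \<omega>)) t"
    using eventually_gt_at_top[of 0]
  proof eventually_elim
    case (elim n)
    have "sqrt n * linear_dev r c p X a n \<omega> = sqrt n * (\<Sum>i<n. \<xi> i \<omega>) / n" for \<omega>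
      using elim by (simp add: linear_dev_eq \<xi>_def)
    moreover have "sqrt n * y / n = y / sqrt n" for y
      using elim by (simp add: field_simps)
    ultimately have "(\<Sum>i<n. \<xi> i \<omega>) / sqrt n = sqrt n * linear_dev r c p X a n \<omega>" for \<omega>
      by simp
    then show ?case by simp
  qed
qed

end

text \<open>The sample supplies a centred variable whose second moment is this number, which
  replaces an appeal to the Cauchy-Schwarz inequality.\<close>

lemma letter_var_nonneg: "letter_var r p a \<ge> 0"
  unfolding centered_letter_value_moment2(2)[of a 0, symmetric] by simp

end

end

end

context prob_space
begin

subsection \<open>The two-sample delta method\<close>

lemma empirical_moment2:
  assumes iid: "iid_sample M r c p X" and inj: "inj_on c {1..r}" and "n > 0" and j: "j \<in> {1..r}"
  shows "integrable M (\<lambda>\<omega>. (empirical c X n \<omega> j - p j)\<^sup>2)"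
    and "expectation (\<lambda>\<omega>. (empirical c X n \<omega> j - p j)\<^sup>2) = letter_var r p (\<lambda>i. of_bool (i = j)) / n"
proof -
  \<comment> \<open>The coefficient vector is the \<open>j\<close>-th unit vector, so one coordinate
    of the deviation is itself a linear statistic.\<close>
  have "linear_dev r c p X (\<lambda>i. of_bool (i = j)) n \<omega> = empirical c X n \<omega> j - p j" for \<omega>
  proof -
    have "linear_dev r c p X (\<lambda>i. of_bool (i = j)) n \<omega>
        = (\<Sum>i\<in>{1..r}. if i = j then empirical c X n \<omega> j - p j else 0)"
      unfolding linear_dev_def by (intro sum.cong) auto
    with j show ?thesis by simp
  qed
  with linear_dev_moment2[OF iid inj \<open>n > 0\<close>, of "\<lambda>i. of_bool (i = j)"]
  show "integrable M (\<lambda>\<omega>. (empirical c X n \<omega> j - p j)\<^sup>2)"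
    and "expectation (\<lambda>\<omega>. (empirical c X n \<omega> j - p j)\<^sup>2) = letter_var r p (\<lambda>i. of_bool (i = j)) / n"
    by simp_all
qed

text \<open>The central limit theorem is available at rate \<open>sqrt n\<close>, not at rate
  \<tau>. The second moment of the difference is
  \<open>(sqrt (\<tau>\<^sup>2 / n) - sqrt A)\<^sup>2\<close> times the letter variance, which tends
  to 0.\<close>

lemma rescaled_linear_dev:
  assumes iid: "iid_sample M r c p X" and inj: "inj_on c {1..r}"
    and n: "filterlim n at_top sequentially"
    and \<tau>: "\<And>k. \<tau> k \<ge> 0" "(\<lambda>k. (\<tau> k)\<^sup>2 / real (n k)) \<longlonglongrightarrow> A"
  shows "(\<lambda>k. expectation (\<lambda>\<omega>. min 1
    \<bar>(\<tau> k - sqrt A * sqrt (real (n k))) * linear_dev r c p X a (n k) \<omega>\<bar>)) \<longlonglongrightarrow> 0"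
proof -
  define d where "d k = \<tau> k - sqrt A * sqrt (real (n k))" for k
  have pos: "\<forall>\<^sub>F k in sequentially. n k > 0"
    by (rule eventually_compose_filterlim[OF eventually_gt_at_top n])
  have "(\<lambda>k. (sqrt ((\<tau> k)\<^sup>2 / real (n k)) - sqrt A)\<^sup>2 * letter_var r p a) \<longlonglongrightarrow> (sqrt A - sqrt A)\<^sup>2 * letter_var r p a"
    by (intro tendsto_intros \<tau>)
  then have lim: "(\<lambda>k. (sqrt ((\<tau> k)\<^sup>2 / real (n k)) - sqrt A)\<^sup>2 * letter_var r p a) \<longlonglongrightarrow> 0"
    by simp
  show ?thesis
    unfolding d_def[symmetric]
  proof (rule expectation_min_1_L2)
    show "(\<lambda>\<omega>. d k * linear_dev r c p X a (n k) \<omega>) \<in> borel_measurable M" for k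
      using linear_dev_measurable[OF iid] by measurable
    show "\<forall>\<^sub>F k in sequentially. integrable M (\<lambda>\<omega>. (d k * linear_dev r c p X a (n k) \<omega>)\<^sup>2)"
      using pos
      by eventually_elim (auto simp: power_mult_distrib linear_dev_moment2[OF iid inj])
    have "\<forall>\<^sub>F k in sequentially. (sqrt ((\<tau> k)\<^sup>2 / real (n k)) - sqrt A)\<^sup>2 * letter_var r p a
        = expectation (\<lambda>\<omega>. (d k * linear_dev r c p X a (n k) \<omega>)\<^sup>2)"
      using pos
    proof eventually_elim
      case (elim k)
      have "sqrt ((\<tau> k)\<^sup>2 / real (n k)) - sqrt A = d k / sqrt (n k)"
        using elim \<tau>(1)[of k] by (simp add: d_def real_sqrt_divide field_simps)
      with elim show ?case
        by (simp add: power_mult_distrib power_divide linear_dev_moment2[OF iid inj])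
    qed
    from Lim_transform_eventually[OF lim this]
    show "(\<lambda>k. expectation (\<lambda>\<omega>. (d k * linear_dev r c p X a (n k) \<omega>)\<^sup>2)) \<longlonglongrightarrow> 0" .
  qed
qed

lemma indep_linear_dev:
  assumes "indep_samples M r c X Y"
  shows "indep_var borel (linear_dev r c p X a n) borel (linear_dev r c q Y b m)"
proof -
  \<comment> \<open>\<open>G\<close> is the statistic as a functional of the whole path: the path
    plays the sample and \<open>()\<close> is a dummy outcome. Only indices in \<open>{1..n}\<close>
    enter, so restricting the path to \<open>{1..}\<close> changes nothing.\<close>
  define G where "G p a n x = linear_dev r c p (\<lambda>i _. x i) a n ()" for p a n and x :: "nat \<Rightarrow> 'b"
  have [measurable]: "G p a n \<in> borel_measurable (\<Pi>\<^sub>M i\<in>{1..}. alphabet r c)" for p a n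
  proof -
    have "(\<lambda>x. of_bool (x i = c j) :: real) \<in> borel_measurable (\<Pi>\<^sub>M i\<in>{1..}. alphabet r c)"
      if "i \<in> {1..n}" for i j
      using that by (intro measurable_compose[where f = "\<lambda>x. x i", OF measurable_component_singleton])
        (auto simp: alphabet_def)
    then show ?thesis
      unfolding G_def linear_dev_def empirical_def
      by (intro borel_measurable_sum borel_measurable_times borel_measurable_diff) auto
  qed
  have eq: "G p a n \<circ> (\<lambda>\<omega>. \<lambda>i\<in>{1..}. X i \<omega>) = linear_dev r c p X a n" for p a n and X :: "nat \<Rightarrow> 'a \<Rightarrow> 'b"
    by (auto simp: G_def linear_dev_def empirical_def fun_eq_iff)
  have "indep_var borel (G p a n \<circ> (\<lambda>\<omega>. \<lambda>i\<in>{1..}. X i \<omega>)) borel (G q b m \<circ> (\<lambda>\<omega>. \<lambda>i\<in>{1..}. Y i \<omega>))"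
    by (rule indep_var_compose[OF assms[unfolded indep_samples_def]]) measurable
  then show ?thesis unfolding eq .
qed

lemma two_sample_delta_method:
  fixes f :: "nat \<Rightarrow> real \<times> real \<Rightarrow> real"
  assumes X: "iid_sample M r c p X" and Y: "iid_sample M r c q Y" and inj: "inj_on c {1..r}"
    and indep: "indep_samples M r c X Y"
    and deriv: "\<And>j. j \<in> {1..r} \<Longrightarrow>
      (f j has_derivative (\<lambda>z. a j * fst z + b j * snd z)) (at (p j, q j))"
    and f [measurable]: "\<And>j. f j \<in> borel_measurable borel"
    and n: "filterlim n at_top sequentially" and m: "filterlim m at_top sequentially"
    and \<tau>: "\<And>k. \<tau> k \<ge> 0"
    and A: "(\<lambda>k. (\<tau> k)\<^sup>2 / real (n k)) \<longlonglongrightarrow> A" and B: "(\<lambda>k. (\<tau> k)\<^sup>2 / real (m k)) \<longlonglongrightarrow> B"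
  shows "converges_in_law M
    (\<lambda>k \<omega>. \<tau> k * ((\<Sum>j\<in>{1..r}. f j (empirical c X (n k) \<omega> j, empirical c Y (m k) \<omega> j))
      - (\<Sum>j\<in>{1..r}. f j (p j, q j))))
    (centered_normal (A * letter_var r p a + B * letter_var r q b))"
proof (rule converges_in_law_centered_normalI)
  define W where "W j k \<omega> = (empirical c X (n k) \<omega> j, empirical c Y (m k) \<omega> j)" for j k \<omega>
  define Z where "Z k \<omega> = \<tau> k * ((\<Sum>j\<in>{1..r}. f j (W j k \<omega>)) - (\<Sum>j\<in>{1..r}. f j (p j, q j)))" for k \<omega>
  have AB: "A \<ge> 0" "B \<ge> 0"
    using LIMSEQ_le_const[OF A, of 0] LIMSEQ_le_const[OF B, of 0] by auto
  have pos: "\<forall>\<^sub>F k in sequentially. n k > 0 \<and> m k > 0"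
    by (intro eventually_conj eventually_compose_filterlim[OF eventually_gt_at_top n]
        eventually_compose_filterlim[OF eventually_gt_at_top m])
  have W: "W j k \<in> borel_measurable M" if "j \<in> {1..r}" for j k
    unfolding W_def using empirical_measurable[OF X that] empirical_measurable[OF Y that]
    by (intro borel_measurable_Pair) auto
  have Z [measurable]: "Z k \<in> borel_measurable M" for k
    unfolding Z_def
    by (intro borel_measurable_times borel_measurable_diff borel_measurable_sum
        measurable_compose[OF W f]) auto
  then show "(\<lambda>\<omega>. \<tau> k * ((\<Sum>j\<in>{1..r}. f j (empirical c X (n k) \<omega> j, empirical c Y (m k) \<omega> j))
      - (\<Sum>j\<in>{1..r}. f j (p j, q j)))) \<in> borel_measurable M" for k
    unfolding Z_def W_def .
  show "0 \<le> A * letter_var r p a + B * letter_var r q b"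
    using AB letter_var_nonneg[OF X inj] letter_var_nonneg[OF Y inj] by simp

  define LX where "LX k = linear_dev r c p X a (n k)" for k
  define LY where "LY k = linear_dev r c q Y b (m k)" for k
  have [measurable]: "LX k \<in> borel_measurable M" "LY k \<in> borel_measurable M" for k
    unfolding LX_def LY_def by (intro linear_dev_measurable[OF X] linear_dev_measurable[OF Y])+
  \<comment> \<open>\<open>L\<close> is the linear part with \<tau> replaced by the exact rates
    \<open>sqrt A * sqrt n\<close> and \<open>sqrt B * sqrt m\<close>, so that the central limit
    theorem applies to each sample.\<close>
  define L where "L k \<omega> = sqrt A * (sqrt (n k) * LX k \<omega>) + sqrt B * (sqrt (m k) * LY k \<omega>)" for k \<omega>

  define R where "R j k \<omega> = \<tau> k * (f j (W j k \<omega>) - f j (p j, q j)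
      - (a j * fst (W j k \<omega> - (p j, q j)) + b j * snd (W j k \<omega> - (p j, q j))))" for j k \<omega>
  have R: "(\<lambda>k. expectation (\<lambda>\<omega>. min 1 \<bar>R j k \<omega>\<bar>)) \<longlonglongrightarrow> 0" if j: "j \<in> {1..r}" for j
    unfolding R_def
  proof (rule delta_remainder[OF deriv[OF j] f W[OF j]])
    define s s' where "s = letter_var r p (\<lambda>i. of_bool (i = j))"
      and "s' = letter_var r q (\<lambda>i. of_bool (i = j))"
    have norm: "(norm (W j k \<omega> - (p j, q j)))\<^sup>2
        = (empirical c X (n k) \<omega> j - p j)\<^sup>2 + (empirical c Y (m k) \<omega> j - q j)\<^sup>2" for k \<omega>
      by (simp add: W_def norm_Pair)
    note moments = empirical_moment2[OF X inj _ j] empirical_moment2[OF Y inj _ j]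
    show "\<forall>\<^sub>F k in sequentially. integrable M (\<lambda>\<omega>. (norm (W j k \<omega> - (p j, q j)))\<^sup>2)"
      using pos by eventually_elim (simp add: norm moments)
    have E: "\<forall>\<^sub>F k in sequentially. s / n k + s' / m k = expectation (\<lambda>\<omega>. (norm (W j k \<omega> - (p j, q j)))\<^sup>2)"
      using pos by eventually_elim (simp add: norm moments s_def s'_def)
    have inv: "(\<lambda>k. s / real (n k)) \<longlonglongrightarrow> 0" "(\<lambda>k. s' / real (m k)) \<longlonglongrightarrow> 0"
      by (intro real_tendsto_divide_at_top[OF tendsto_const]
          filterlim_compose[OF filterlim_real_sequentially] n m)+
    have "(\<lambda>k. s / n k + s' / m k) \<longlonglongrightarrow> 0"
      using tendsto_add[OF inv] by simp
    from Lim_transform_eventually[OF this E]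
    show "(\<lambda>k. expectation (\<lambda>\<omega>. (norm (W j k \<omega> - (p j, q j)))\<^sup>2)) \<longlonglongrightarrow> 0" .
    \<comment> \<open>The second moment of the deviation scaled by \<tau> converges; adding 1 to the
      limit gives an eventual upper bound, even if the limit is approached from above.\<close>
    have "(\<lambda>k. (\<tau> k)\<^sup>2 / n k * s + (\<tau> k)\<^sup>2 / m k * s') \<longlonglongrightarrow> A * s + B * s'"
      by (intro tendsto_intros A B)
    then have "\<forall>\<^sub>F k in sequentially. (\<tau> k)\<^sup>2 / n k * s + (\<tau> k)\<^sup>2 / m k * s' < A * s + B * s' + 1"
      by (rule order_tendstoD) simp
    with E show "\<forall>\<^sub>F k in sequentially. (\<tau> k)\<^sup>2 * expectation (\<lambda>\<omega>. (norm (W j k \<omega> - (p j, q j)))\<^sup>2)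
        \<le> A * s + B * s' + 1"
    proof eventually_elim
      case (elim k)
      from elim(1)[symmetric] elim(2) show ?case by (simp add: algebra_simps)
    qed
  qed

  have diff: "Z k \<omega> - L k \<omega> = (\<Sum>j\<in>{1..r}. R j k \<omega>)
      + ((\<tau> k - sqrt A * sqrt (n k)) * LX k \<omega> + (\<tau> k - sqrt B * sqrt (m k)) * LY k \<omega>)" for k \<omega>
  proof -
    have "(\<Sum>j\<in>{1..r}. R j k \<omega>) = Z k \<omega> - \<tau> k * LX k \<omega> - \<tau> k * LY k \<omega>"
      by (simp add: R_def Z_def LX_def LY_def linear_dev_def W_def sum_subtractf sum.distrib
          sum_distrib_left right_diff_distrib distrib_left)
    then show ?thesis by (simp add: L_def algebra_simps)
  qed
  have ZL: "(\<lambda>k. expectation (\<lambda>\<omega>. min 1 \<bar>Z k \<omega> - L k \<omega>\<bar>)) \<longlonglongrightarrow> 0"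
    unfolding diff
  proof (intro expectation_min_1_add expectation_min_1_sum R)
    show R_meas: "R j k \<in> borel_measurable M" if j: "j \<in> {1..r}" for j k
    proof -
      have "R j k = (\<lambda>\<omega>. \<tau> k * (f j (W j k \<omega>) - f j (p j, q j)
          - (a j * (empirical c X (n k) \<omega> j - p j) + b j * (empirical c Y (m k) \<omega> j - q j))))"
        by (simp add: R_def W_def fun_eq_iff)
      then show ?thesis
        using measurable_compose[OF W[OF j] f] empirical_measurable[OF X j] empirical_measurable[OF Y j]
        by simp
    qed
    show "(\<lambda>\<omega>. \<Sum>j\<in>{1..r}. R j k \<omega>) \<in> borel_measurable M" for k
      by (intro borel_measurable_sum R_meas)
    show "(\<lambda>k. expectation (\<lambda>\<omega>. min 1 \<bar>(\<tau> k - sqrt A * sqrt (n k)) * LX k \<omega>\<bar>)) \<longlonglongrightarrow> 0"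
      unfolding LX_def by (rule rescaled_linear_dev[OF X inj n \<tau> A])
    show "(\<lambda>k. expectation (\<lambda>\<omega>. min 1 \<bar>(\<tau> k - sqrt B * sqrt (m k)) * LY k \<omega>\<bar>)) \<longlonglongrightarrow> 0"
      unfolding LY_def by (rule rescaled_linear_dev[OF Y inj m \<tau> B])
  qed auto

  show "(\<lambda>k. char (distr M borel (\<lambda>\<omega>. \<tau> k *
      ((\<Sum>j\<in>{1..r}. f j (empirical c X (n k) \<omega> j, empirical c Y (m k) \<omega> j))
      - (\<Sum>j\<in>{1..r}. f j (p j, q j))))) t)
    \<longlonglongrightarrow> exp (- (A * letter_var r p a + B * letter_var r q b) * t\<^sup>2 / 2)" for t
    unfolding Z_def[unfolded W_def, symmetric]
  proof (rule char_distr_tendsto_cong[OF Z _ ZL])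
    show "L k \<in> borel_measurable M" for k unfolding L_def by measurable
    have ind: "indep_var borel (\<lambda>\<omega>. sqrt A * (sqrt (n k) * LX k \<omega>)) borel (\<lambda>\<omega>. sqrt B * (sqrt (m k) * LY k \<omega>))" for k
      using indep_var_compose[OF indep_linear_dev[OF indep, of p a "n k" q b "m k"],
          of "\<lambda>x. sqrt A * (sqrt (n k) * x)" borel "\<lambda>x. sqrt B * (sqrt (m k) * x)" borel]
      by (simp add: LX_def LY_def comp_def)
    have scale: "char (distr M borel (\<lambda>\<omega>. u * g \<omega>)) t = char (distr M borel g) (u * t)"
      if [measurable]: "g \<in> borel_measurable M" for u :: real and g
      by (simp add: char_def integral_distr mult_ac)
    \<comment> \<open>Independence of the samples factorises the characteristic function, and the
      constants \<open>sqrt A\<close> and \<open>sqrt B\<close> move into the argument.\<close>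
    have "char (distr M borel (L k)) t
        = char (distr M borel (\<lambda>\<omega>. sqrt (n k) * LX k \<omega>)) (sqrt A * t)
        * char (distr M borel (\<lambda>\<omega>. sqrt (m k) * LY k \<omega>)) (sqrt B * t)" for k
      unfolding L_def char_distr_add[OF ind] by (simp add: scale)
    moreover have "(\<lambda>k. char (distr M borel (\<lambda>\<omega>. sqrt (n k) * LX k \<omega>)) (sqrt A * t)
          * char (distr M borel (\<lambda>\<omega>. sqrt (m k) * LY k \<omega>)) (sqrt B * t))
        \<longlonglongrightarrow> exp (- letter_var r p a * (sqrt A * t)\<^sup>2 / 2) * exp (- letter_var r q b * (sqrt B * t)\<^sup>2 / 2)"
      unfolding LX_def LY_def of_real_mult
      by (intro tendsto_mult filterlim_compose[OF char_linear_dev_tendsto[OF X inj] n]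
          filterlim_compose[OF char_linear_dev_tendsto[OF Y inj] m])
    moreover have "exp (- letter_var r p a * (sqrt A * t)\<^sup>2 / 2) * exp (- letter_var r q b * (sqrt B * t)\<^sup>2 / 2)
        = exp (- (A * letter_var r p a + B * letter_var r q b) * t\<^sup>2 / 2)"
      using AB by (simp add: power_mult_distrib algebra_simps add_divide_distrib flip: exp_add)
    ultimately show "(\<lambda>k. char (distr M borel (L k)) t)
        \<longlonglongrightarrow> exp (- (A * letter_var r p a + B * letter_var r q b) * t\<^sup>2 / 2)"
      by (simp flip: of_real_mult)
  qed
qed

end

subsection \<open>The Tsallis divergence\<close>

text \<open>The coefficients are the partial derivatives of the divergence in \<open>p j\<close>.
  The cross terms match because \<open>p j * (p j / q j) powr (\<alpha> - 1)\<close> equals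
  \<open>p j powr \<alpha> * q j powr (1 - \<alpha>)\<close>.\<close>

lemma V1_eq_letter_var:
  assumes "pos_prob_vec r p" "pos_prob_vec r q"
  shows "V1 \<alpha> r p q = letter_var r p (\<lambda>j. \<alpha> / (\<alpha> - 1) * (p j / q j) powr (\<alpha> - 1))"
proof -
  define h where "h j = (p j / q j) powr (\<alpha> - 1)" for j
  have pq: "p j > 0" "q j > 0" if "j \<in> {1..r}" for j
    using assms that by (auto simp: pos_prob_vec_def)
  have sq: "(p j / q j) powr (2 * \<alpha> - 2) = (h j)\<^sup>2" for j
    unfolding h_def power2_eq_square powr_add[symmetric] by (simp add: algebra_simps)
  have ph: "p j * h j = p j powr \<alpha> * q j powr (1 - \<alpha>)" if "j \<in> {1..r}" for j
    using pq[OF that] by (simp add: h_def powr_divide powr_diff field_simps)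
  have "(p i * p j) powr \<alpha> * (q i * q j) powr (1 - \<alpha>) = (p i * h i) * (p j * h j)"
    if "i \<in> {1..r}" "j \<in> {1..r}" for i j
    using pq[OF that(1)] pq[OF that(2)] unfolding ph[OF that(1)] ph[OF that(2)]
    by (simp add: powr_mult)
  then have cross: "(\<Sum>(i, j)\<in>distinct_pairs r. (p i * p j) powr \<alpha> * (q i * q j) powr (1 - \<alpha>))
      = (\<Sum>(i, j)\<in>distinct_pairs r. p i * p j * h i * h j)"
    by (intro sum.cong) (auto simp: distinct_pairs_def mult_ac)
  have scale: "letter_var r p (\<lambda>j. k * h j) = k\<^sup>2 * letter_var r p h" for k
  proof -
    have "letter_var r p (\<lambda>j. k * h j) = (\<Sum>j\<in>{1..r}. k\<^sup>2 * ((h j)\<^sup>2 * p j)) - (\<Sum>j\<in>{1..r}. k * (h j * p j))\<^sup>2"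
      by (simp add: letter_var_def power_mult_distrib mult.assoc)
    then show ?thesis
      by (simp add: letter_var_def power_mult_distrib right_diff_distrib flip: sum_distrib_left)
  qed
  show ?thesis
    unfolding V1_def cross sq h_def[symmetric] scale letter_var_eq[of r p h] ..
qed

text \<open>The coefficients are the partial derivatives in \<open>q j\<close>: the factor
  \<open>1 - \<alpha>\<close> cancels \<open>1 / (\<alpha> - 1)\<close> up to a sign, which the
  quadratic form does not see.\<close>

lemma V2_eq_letter_var:
  assumes "pos_prob_vec r p" "pos_prob_vec r q"
  shows "V2 \<alpha> r p q = letter_var r q (\<lambda>j. - ((p j / q j) powr \<alpha>))"
proof -
  define h where "h j = (p j / q j) powr \<alpha>" for j
  have pq: "p j > 0" "q j > 0" if "j \<in> {1..r}" for j
    using assms that by (auto simp: pos_prob_vec_def)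
  have sq: "(p j / q j) powr (2 * \<alpha>) = (h j)\<^sup>2" for j
    unfolding h_def power2_eq_square powr_add[symmetric] by (simp add: algebra_simps)
  have qh: "q j * h j = p j powr \<alpha> * q j powr (1 - \<alpha>)" if "j \<in> {1..r}" for j
    using pq[OF that] by (simp add: h_def powr_divide powr_diff field_simps)
  have "(p i * p j) powr \<alpha> * (q i * q j) powr (1 - \<alpha>) = (q i * h i) * (q j * h j)"
    if "i \<in> {1..r}" "j \<in> {1..r}" for i j
    using pq[OF that(1)] pq[OF that(2)] unfolding qh[OF that(1)] qh[OF that(2)]
    by (simp add: powr_mult)
  then have cross: "(\<Sum>(i, j)\<in>distinct_pairs r. (p i * p j) powr \<alpha> * (q i * q j) powr (1 - \<alpha>))
      = (\<Sum>(i, j)\<in>distinct_pairs r. q i * q j * h i * h j)"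
    by (intro sum.cong) (auto simp: distinct_pairs_def mult_ac)
  show ?thesis
    unfolding V2_def cross sq h_def[symmetric] letter_var_eq by simp
qed

text \<open>The constant \<open>- 1\<close> cancels, leaving the coordinatewise sums that the delta
  method handles.\<close>

lemma tsallis_diff:
  "tsallis \<alpha> r p q - tsallis \<alpha> r p' q'
    = (\<Sum>j\<in>{1..r}. p j powr \<alpha> * q j powr (1 - \<alpha>) / (\<alpha> - 1))
      - (\<Sum>j\<in>{1..r}. p' j powr \<alpha> * q' j powr (1 - \<alpha>) / (\<alpha> - 1))"
  by (simp add: tsallis_def diff_divide_distrib flip: sum_divide_distrib)

lemma has_derivative_powr_fst:
  fixes x y :: real
  assumes "x > 0"
  shows "((\<lambda>z. fst z powr s) has_derivative (\<lambda>z. s * x powr (s - 1) * fst z)) (at (x, y))"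
proof -
  have "((\<lambda>x. x powr s) has_derivative (\<lambda>h. s * x powr (s - 1) * h)) (at (fst (x, y)))"
    using has_real_derivative_powr[OF assms, of s] by (simp add: has_field_derivative_def)
  from has_derivative_compose[OF has_derivative_fst[OF has_derivative_ident] this]
  show ?thesis by simp
qed

lemma has_derivative_powr_snd:
  fixes x y :: real
  assumes "y > 0"
  shows "((\<lambda>z. snd z powr s) has_derivative (\<lambda>z. s * y powr (s - 1) * snd z)) (at (x, y))"
proof -
  have "((\<lambda>y. y powr s) has_derivative (\<lambda>h. s * y powr (s - 1) * h)) (at (snd (x, y)))"
    using has_real_derivative_powr[OF assms, of s] by (simp add: has_field_derivative_def)
  from has_derivative_compose[OF has_derivative_snd[OF has_derivative_ident] this]
  show ?thesis by simp
qed

text \<open>For \<open>n, m \<ge> 2\<close> the product \<open>(n - 1) * (m - 1)\<close> is at least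
  1, which rearranges to \<open>n * m \<ge> n + m\<close>. The ratio is then at least 1, above any
  admissible \<gamma>.\<close>

lemma harmonic_rate_impossible:
  assumes n: "filterlim n at_top sequentially" and m: "filterlim m at_top sequentially"
    and "\<gamma> < 1"
  shows "\<not> harmonic_rate n m \<gamma>"
proof
  assume "harmonic_rate n m \<gamma>"
  then have "\<forall>\<^sub>F k in sequentially. real (n k) * real (m k) / (real (n k) + real (m k)) < 1"
    unfolding harmonic_rate_def using \<open>\<gamma> < 1\<close> by (rule order_tendstoD)
  moreover have "\<forall>\<^sub>F k in sequentially. n k \<ge> 2" "\<forall>\<^sub>F k in sequentially. m k \<ge> 2"
    by (rule eventually_compose_filterlim[OF eventually_ge_at_top n]
        eventually_compose_filterlim[OF eventually_ge_at_top m])+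
  ultimately have "\<forall>\<^sub>F k in sequentially. False"
  proof eventually_elim
    case (elim k)
    then have "0 \<le> (real (n k) - 1) * (real (m k) - 1) - 1"
      using mult_mono[of 1 "real (n k) - 1" 1 "real (m k) - 1"] by simp
    with elim show False by (simp add: field_simps)
  qed
  then show False by simp
qed

theorem corollary2:
  fixes M :: "'w measure" and X Y :: "nat \<Rightarrow> 'w \<Rightarrow> 'c"
    and r :: nat and c :: "nat \<Rightarrow> 'c" and p q :: "nat \<Rightarrow> real" and \<alpha> :: real
  assumes "prob_space M"
    and "r \<ge> 2" and "inj_on c {1..r}"
    and "pos_prob_vec r p" and "pos_prob_vec r q"
    and "\<alpha> > 0" and "\<alpha> \<noteq> 1"
    and "iid_sample M r c p X" and "iid_sample M r c q Y"
    and "indep_samples M r c X Y"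
  shows
    "converges_in_law M
       (\<lambda>n \<omega>. sqrt (real n) * (tsallis \<alpha> r (empirical c X n \<omega>) q - tsallis \<alpha> r p q))
       (centered_normal (V1 \<alpha> r p q)) \<and>
     converges_in_law M
       (\<lambda>n \<omega>. sqrt (real n) * (tsallis \<alpha> r p (empirical c Y n \<omega>) - tsallis \<alpha> r p q))
       (centered_normal (V2 \<alpha> r p q)) \<and>
     (\<forall>n m \<gamma>. filterlim n at_top sequentially \<longrightarrow> filterlim m at_top sequentially \<longrightarrow>
        \<gamma> \<in> {0<..<1} \<longrightarrow> harmonic_rate n m \<gamma> \<longrightarrow>
        converges_in_law M (\<lambda>k. two_sample_stat \<alpha> r c p q X Y (n k) (m k))
          (centered_normal 1)) \<and>
     (\<forall>n m \<gamma>. filterlim n at_top sequentially \<longrightarrow> filterlim m at_top sequentially \<longrightarrow>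
        \<gamma> \<in> {0<..<1} \<longrightarrow> proportion_rate n m \<gamma> \<longrightarrow>
        (\<forall>\<^sub>F k in sequentially. real (n k) * V2 \<alpha> r p q + real (m k) * V1 \<alpha> r p q \<noteq> 0) \<longrightarrow>
        converges_in_law M (\<lambda>k. two_sample_stat \<alpha> r c p q X Y (n k) (m k))
          (centered_normal 1))"
proof (intro conjI allI impI)
  interpret prob_space M by fact
  note inj = \<open>inj_on c {1..r}\<close> and X = \<open>iid_sample M r c p X\<close> and Y = \<open>iid_sample M r c q Y\<close>
    and indep = \<open>indep_samples M r c X Y\<close> and pv = \<open>pos_prob_vec r p\<close> \<open>pos_prob_vec r q\<close>
  have pq: "p j > 0" "q j > 0" if "j \<in> {1..r}" for j
    using pv that by (auto simp: pos_prob_vec_def)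
  have \<alpha>: "\<alpha> - 1 \<noteq> 0" using \<open>\<alpha> \<noteq> 1\<close> by simp
  define a where "a j = \<alpha> / (\<alpha> - 1) * (p j / q j) powr (\<alpha> - 1)" for j
  define b where "b j = - ((p j / q j) powr \<alpha>)" for j
  have V1: "V1 \<alpha> r p q = letter_var r p a" and V2: "V2 \<alpha> r p q = letter_var r q b"
    using V1_eq_letter_var[OF pv] V2_eq_letter_var[OF pv] unfolding a_def b_def by auto
  have a: "\<alpha> * p j powr (\<alpha> - 1) * q j powr (1 - \<alpha>) / (\<alpha> - 1) = a j" if "j \<in> {1..r}" for j
    using pq[OF that] by (simp add: a_def powr_divide powr_diff field_simps)
  have b: "p j powr \<alpha> * ((1 - \<alpha>) * q j powr (1 - \<alpha> - 1)) / (\<alpha> - 1) = b j" if "j \<in> {1..r}" for j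
  proof -
    have "q j powr (1 - \<alpha> - 1) = 1 / q j powr \<alpha>" by (simp add: powr_minus_divide)
    with pq[OF that] \<alpha> show ?thesis by (simp add: b_def powr_divide field_simps)
  qed
  have [measurable]: "(fst :: real \<times> real \<Rightarrow> real) \<in> borel_measurable borel"
      "(snd :: real \<times> real \<Rightarrow> real) \<in> borel_measurable borel"
    by (intro borel_measurable_continuous_onI continuous_intros)+
  have letter_var_0: "letter_var r p (\<lambda>_. 0) = 0" for p by (simp add: letter_var_def)
  \<comment> \<open>Equality with 1 fails at \<open>k = 0\<close>, where division by zero yields 0;
    hence only eventual equality.\<close>
  have sqrt_rate: "(\<lambda>k. (sqrt (real k))\<^sup>2 / real k) \<longlonglongrightarrow> 1"
    by (rule tendsto_eventually) (auto intro!: eventually_mono[OF eventually_gt_at_top[of 0]])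

  \<comment> \<open>The second sample enters with the same size as a placeholder: the summands
    ignore it, so its coefficients, and with them its variance term, are 0.\<close>
  have "converges_in_law M
      (\<lambda>k \<omega>. sqrt (real k) * ((\<Sum>j\<in>{1..r}. fst (empirical c X k \<omega> j, empirical c Y k \<omega> j) powr \<alpha> * q j powr (1 - \<alpha>) / (\<alpha> - 1))
        - (\<Sum>j\<in>{1..r}. fst (p j, q j) powr \<alpha> * q j powr (1 - \<alpha>) / (\<alpha> - 1))))
      (centered_normal (1 * letter_var r p a + 1 * letter_var r q (\<lambda>_. 0)))"
  proof (rule two_sample_delta_method[where f = "\<lambda>j z. fst z powr \<alpha> * q j powr (1 - \<alpha>) / (\<alpha> - 1)", OF X Y inj indep])
    fix j assume j: "j \<in> {1..r}"
    have "((\<lambda>z. fst z powr \<alpha> * q j powr (1 - \<alpha>) / (\<alpha> - 1)) has_derivative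
        (\<lambda>z. \<alpha> * p j powr (\<alpha> - 1) * fst z * q j powr (1 - \<alpha>) / (\<alpha> - 1))) (at (p j, q j))"
      unfolding divide_inverse by (intro has_derivative_mult_left has_derivative_powr_fst pq j)
    then show "((\<lambda>z. fst z powr \<alpha> * q j powr (1 - \<alpha>) / (\<alpha> - 1)) has_derivative
        (\<lambda>z. a j * fst z + 0 * snd z)) (at (p j, q j))"
      by (simp add: a[OF j, symmetric] mult_ac)
  qed (use sqrt_rate in \<open>simp_all add: filterlim_ident\<close>)
  then show "converges_in_law M
       (\<lambda>n \<omega>. sqrt (real n) * (tsallis \<alpha> r (empirical c X n \<omega>) q - tsallis \<alpha> r p q))
       (centered_normal (V1 \<alpha> r p q))"
    by (simp add: tsallis_diff V1 letter_var_0)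

  have "converges_in_law M
      (\<lambda>k \<omega>. sqrt (real k) * ((\<Sum>j\<in>{1..r}. p j powr \<alpha> * snd (empirical c X k \<omega> j, empirical c Y k \<omega> j) powr (1 - \<alpha>) / (\<alpha> - 1))
        - (\<Sum>j\<in>{1..r}. p j powr \<alpha> * snd (p j, q j) powr (1 - \<alpha>) / (\<alpha> - 1))))
      (centered_normal (1 * letter_var r p (\<lambda>_. 0) + 1 * letter_var r q b))"
  proof (rule two_sample_delta_method[where f = "\<lambda>j z. p j powr \<alpha> * snd z powr (1 - \<alpha>) / (\<alpha> - 1)", OF X Y inj indep])
    fix j assume j: "j \<in> {1..r}"
    have "((\<lambda>z. p j powr \<alpha> * snd z powr (1 - \<alpha>) / (\<alpha> - 1)) has_derivative
        (\<lambda>z. p j powr \<alpha> * ((1 - \<alpha>) * q j powr (1 - \<alpha> - 1) * snd z) / (\<alpha> - 1))) (at (p j, q j))"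
      unfolding divide_inverse by (intro has_derivative_mult_left has_derivative_mult_right has_derivative_powr_snd pq j)
    then show "((\<lambda>z. p j powr \<alpha> * snd z powr (1 - \<alpha>) / (\<alpha> - 1)) has_derivative
        (\<lambda>z. 0 * fst z + b j * snd z)) (at (p j, q j))"
      by (simp add: b[OF j, symmetric] mult_ac)
  qed (use sqrt_rate in \<open>simp_all add: filterlim_ident\<close>)
  then show "converges_in_law M
       (\<lambda>n \<omega>. sqrt (real n) * (tsallis \<alpha> r p (empirical c Y n \<omega>) - tsallis \<alpha> r p q))
       (centered_normal (V2 \<alpha> r p q))"
    by (simp add: tsallis_diff V2 letter_var_0)

  fix n m :: "nat \<Rightarrow> nat" and \<gamma> :: real
  assume n: "filterlim n at_top sequentially" and m: "filterlim m at_top sequentially"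
    and \<gamma>: "\<gamma> \<in> {0<..<1}"
  {
    assume "harmonic_rate n m \<gamma>"
    then show "converges_in_law M (\<lambda>k. two_sample_stat \<alpha> r c p q X Y (n k) (m k)) (centered_normal 1)"
      using harmonic_rate_impossible[OF n m] \<gamma> by simp
  next
    assume "proportion_rate n m \<gamma>"
      and nz: "\<forall>\<^sub>F k in sequentially. real (n k) * V2 \<alpha> r p q + real (m k) * V1 \<alpha> r p q \<noteq> 0"
    define v w where "v = V1 \<alpha> r p q" and "w = V2 \<alpha> r p q"
    have vw0: "v \<ge> 0" "w \<ge> 0"
      unfolding v_def w_def V1 V2 by (intro letter_var_nonneg[OF X inj] letter_var_nonneg[OF Y inj])+
    moreover have "v \<noteq> 0 \<or> w \<noteq> 0"
      using eventually_happens[OF nz] by (auto simp: v_def w_def)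
    ultimately have vw: "v > 0 \<or> w > 0" by auto
    \<comment> \<open>This is the limit of \<open>(n * w + m * v) / (n + m)\<close>. Both weights
      are positive, so a single positive variance makes it positive.\<close>
    define d where "d = \<gamma> * w + (1 - \<gamma>) * v"
    have d: "d > 0"
      using vw vw0 \<gamma> by (auto simp: d_def intro: add_pos_nonneg add_nonneg_pos)
    define \<rho> where "\<rho> k = real (n k) / (real (n k) + real (m k))" for k
    have \<rho>: "\<rho> \<longlonglongrightarrow> \<gamma>"
      using \<open>proportion_rate n m \<gamma>\<close> unfolding proportion_rate_def \<rho>_def .
    define \<tau> where "\<tau> k = sqrt (real (m k) * real (n k) / (real (n k) * w + real (m k) * v))" for k
    have pos: "\<forall>\<^sub>F k in sequentially. n k > 0" "\<forall>\<^sub>F k in sequentially. m k > 0"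
      by (rule eventually_compose_filterlim[OF eventually_gt_at_top n]
          eventually_compose_filterlim[OF eventually_gt_at_top m])+
    have \<tau>2: "(\<tau> k)\<^sup>2 = real (m k) * real (n k) / (real (n k) * w + real (m k) * v)" for k
      unfolding \<tau>_def using vw0 by simp
    \<comment> \<open>Dividing numerator and denominator by \<open>n + m\<close> expresses both
      rates through the proportion \<open>\<rho> k\<close> alone, whose limit is given.\<close>
    have rates: "\<forall>\<^sub>F k in sequentially. (1 - \<rho> k) / (\<rho> k * w + (1 - \<rho> k) * v) = (\<tau> k)\<^sup>2 / real (n k)"
        "\<forall>\<^sub>F k in sequentially. \<rho> k / (\<rho> k * w + (1 - \<rho> k) * v) = (\<tau> k)\<^sup>2 / real (m k)"
    proof -
      have eqs: "(1 - \<rho> k) / (\<rho> k * w + (1 - \<rho> k) * v) = real (m k) / (real (n k) * w + real (m k) * v)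
          \<and> \<rho> k / (\<rho> k * w + (1 - \<rho> k) * v) = real (n k) / (real (n k) * w + real (m k) * v)"
        if "n k > 0" for k
      proof -
        define N where "N = real (n k) + real (m k)"
        have "N > 0" using that by (simp add: N_def)
        have 1: "\<rho> k = real (n k) / N" "1 - \<rho> k = real (m k) / N"
          using \<open>N > 0\<close> by (auto simp: \<rho>_def N_def field_simps)
        have 2: "\<rho> k * w + (1 - \<rho> k) * v = (real (n k) * w + real (m k) * v) / N"
          unfolding 1(2) unfolding 1(1) by (simp add: add_divide_distrib)
        show ?thesis unfolding 2 unfolding 1(2) unfolding 1(1) using \<open>N > 0\<close> by simp
      qed
      show "\<forall>\<^sub>F k in sequentially. (1 - \<rho> k) / (\<rho> k * w + (1 - \<rho> k) * v) = (\<tau> k)\<^sup>2 / real (n k)"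
        using pos by eventually_elim (simp add: eqs \<tau>2)
      show "\<forall>\<^sub>F k in sequentially. \<rho> k / (\<rho> k * w + (1 - \<rho> k) * v) = (\<tau> k)\<^sup>2 / real (m k)"
        using pos by eventually_elim (simp add: eqs \<tau>2)
    qed
    have "(\<lambda>k. (1 - \<rho> k) / (\<rho> k * w + (1 - \<rho> k) * v)) \<longlonglongrightarrow> (1 - \<gamma>) / d"
      "(\<lambda>k. \<rho> k / (\<rho> k * w + (1 - \<rho> k) * v)) \<longlonglongrightarrow> \<gamma> / d"
      using d unfolding d_def by (auto intro!: tendsto_intros \<rho>)
    then have A: "(\<lambda>k. (\<tau> k)\<^sup>2 / real (n k)) \<longlonglongrightarrow> (1 - \<gamma>) / d"
      and B: "(\<lambda>k. (\<tau> k)\<^sup>2 / real (m k)) \<longlonglongrightarrow> \<gamma> / d"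
      using rates by (auto intro: Lim_transform_eventually)
    have "converges_in_law M
      (\<lambda>k \<omega>. \<tau> k * ((\<Sum>j\<in>{1..r}. fst (empirical c X (n k) \<omega> j, empirical c Y (m k) \<omega> j) powr \<alpha>
          * snd (empirical c X (n k) \<omega> j, empirical c Y (m k) \<omega> j) powr (1 - \<alpha>) / (\<alpha> - 1))
        - (\<Sum>j\<in>{1..r}. fst (p j, q j) powr \<alpha> * snd (p j, q j) powr (1 - \<alpha>) / (\<alpha> - 1))))
      (centered_normal ((1 - \<gamma>) / d * letter_var r p a + \<gamma> / d * letter_var r q b))"
    proof (rule two_sample_delta_method[where f = "\<lambda>_ z. fst z powr \<alpha> * snd z powr (1 - \<alpha>) / (\<alpha> - 1)",
          OF X Y inj indep _ _ n m _ A B])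
      fix j assume j: "j \<in> {1..r}"
      have "((\<lambda>z. fst z powr \<alpha> * snd z powr (1 - \<alpha>) / (\<alpha> - 1)) has_derivative
          (\<lambda>z. (fst (p j, q j) powr \<alpha> * ((1 - \<alpha>) * q j powr (1 - \<alpha> - 1) * snd z)
            + \<alpha> * p j powr (\<alpha> - 1) * fst z * snd (p j, q j) powr (1 - \<alpha>)) / (\<alpha> - 1))) (at (p j, q j))"
        unfolding divide_inverse by (intro has_derivative_mult_left has_derivative_mult has_derivative_powr_fst
            has_derivative_powr_snd pq j)
      then show "((\<lambda>z. fst z powr \<alpha> * snd z powr (1 - \<alpha>) / (\<alpha> - 1)) has_derivative
          (\<lambda>z. a j * fst z + b j * snd z)) (at (p j, q j))"
        by (simp add: a[OF j, symmetric] b[OF j, symmetric] mult_ac add_divide_distrib add.commute)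
    qed (use vw0 in \<open>simp_all add: \<tau>_def\<close>)
    \<comment> \<open>The weighted variances add up to \<open>d / d\<close>, which is why this
      normalisation yields the standard normal law.\<close>
    moreover have "(1 - \<gamma>) / d * letter_var r p a + \<gamma> / d * letter_var r q b = 1"
      using d unfolding V1[symmetric] V2[symmetric] by (simp add: v_def[symmetric] w_def[symmetric] field_simps)
        (simp add: d_def algebra_simps)
    ultimately show "converges_in_law M (\<lambda>k. two_sample_stat \<alpha> r c p q X Y (n k) (m k)) (centered_normal 1)"
      by (simp add: two_sample_stat_def[abs_def] tsallis_diff \<tau>_def v_def w_def)
  }
qed

end
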